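(* Let $q$ be a prime power and $m$ a positive integer with $q^m\equiv 3\pmod 4$, and let $N$ be an odd positive integer dividing $(q^m-1)/(q-1)$. Assume that the Gauss periods $\psi_{\mathbb{F}_{q^m}}(C_i^{(N,q^m)})$, $0\le i\le N-1$, take exactly three rational values $\alpha_1,\alpha_2,\alpha_3$ with $\alpha_1-\alpha_2=\alpha_2-\alpha_3>0$. Let $I_1,I_2,I_3$, a partition $S_1,S_2$ of $I_2$, the set $X\subseteq\mathbb{Z}_{2N}$ and the set $D_X\subseteq\mathbb{F}_{q^{2m}}$ be as defined in the context. Suppose that for every integer $c$ $$2\psi_{\mathbb{F}_{q^m}}\Bigl(\omega^c\bigcup_{\ell\in X}C_\ell^{(2N,q^m)}\Bigr)-\psi_{\mathbb{F}_{q^m}}\Bigl(\omega^c\bigcup_{\ell\in 2^{-1}I_2}C_\ell^{(N,q^m)}\Bigr)=\begin{cases}\pm G_{q^m}(\eta), & \text{if } c \bmod N\in 2^{-1}I_2,\\ 0, &\text{otherwise}\end{cases}$$ (the sign may depend on $c$). Then the nontrivial additive character values of $D_X$ take exactly the two values $$\frac{(q^m-1)(2|I_1|+|I_2|)}{2N}\quad\text{and}\quad -q^m+\frac{(q^m-1)(2|I_1|+|I_2|)}{2N},$$ and $\mathrm{Cay}(\mathbb{F}_{q^{2m}},D_X)$ is a strongly regular graph of negative Latin square type with parameters $(q^{2m},\,r(q^m+1),\,-q^m+r^2+3r,\,r^2+r)$, where $r=(|I_2|+2|I_1|)(q^m-1)/(2N)$.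
   Context: Notation. For a prime power $Q$, $\psi_{\mathbb{F}_Q}$ is the canonical additive character $x\mapsto \exp(2\pi i\,\mathrm{Tr}_{Q/p}(x)/p)$ of $\mathbb{F}_Q$ ($p$ the characteristic), and $\psi_{\mathbb{F}_Q}(A)=\sum_{x\in A}\psi_{\mathbb{F}_Q}(x)$ for $A\subseteq\mathbb{F}_Q$. The nontrivial additive character values of $D\subseteq \mathbb{F}_Q$ are the numbers $\psi_{\mathbb{F}_Q}(yD)$, $y\in\mathbb{F}_Q^*$. For a multiplicative character $\chi$ of $\mathbb{F}_Q$, $G_Q(\chi)=\sum_{x\in\mathbb{F}_Q^*}\chi(x)\psi_{\mathbb{F}_Q}(x)$; $\eta$ is the quadratic character of $\mathbb{F}_{q^m}$. Fix a primitive element $\gamma$ of $\mathbb{F}_{q^{2m}}$ and let $\omega=\gamma^{q^m+1}$, a primitive element of $\mathbb{F}_{q^m}$. For $K\mid q^m-1$ let $C_i^{(K,q^m)}=\omega^i\langle\omega^K\rangle$, and for $K\mid q^{2m}-1$ let $C_i^{(K,q^{2m})}=\gamma^i\langle\gamma^K\rangle$ (indices modulo $K$). $I_j=\{i \bmod N:\psi_{\mathbb{F}_{q^m}}(C_i^{(N,q^m)})=\alpha_j\}\subseteq\mathbb{Z}_N$ for $j=1,2,3$. Since $N$ is odd, $2$ and $4$ are invertible modulo $N$, and $2^{-1}I_j,\,4^{-1}I_j\subseteq\mathbb{Z}_N$ denote the images of $I_j$ under multiplication by $2^{-1},4^{-1}$ modulo $N$. $S_1,S_2$ is a partition of $I_2$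 into two (possibly empty) disjoint parts, $S_i''=4^{-1}S_i\subseteq\mathbb{Z}_N$ for $i=1,2$, and $$X=2S_1''\cup(2S_2''+N)\subseteq\mathbb{Z}_{2N},$$ where for $j\in\mathbb{Z}_N$ the element $2j$ is taken modulo $2N$. Further $$Y_X=\{Ni+4j: (i,j)\in(\{0,3\}\times S_1'')\cup(\{1,2\}\times S_2'')\}\cup\{Ni+4j: i\in\{0,1,2,3\},\ j\in 4^{-1}I_1\}\subseteq\mathbb{Z}_{4N}$$ (with $4j$ taken modulo $4N$), and $D_X=\bigcup_{i\in Y_X}C_i^{(4N,q^{2m})}$. $\mathrm{Cay}(G,D)$ is the graph on $G$ with $x,y$ adjacent iff $x-y\in D$. A strongly regular graph with parameters $(v,k,\lambda,\mu)$ is a $k$-regular simple graph on $v$ vertices in which distinct adjacent (resp. non-adjacent) vertices have exactly $\lambda$ (resp. $\mu$) common neighbours; it is of negative Latin square type if its parameters are $(n^2,\,r(n+1),\,-n+r^2+3r,\,r^2+r)$ for some $n,r$. *)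

theory Defs
  imports
    Complex_Main
    "HOL-Computational_Algebra.Primes"
    "HOL-Number_Theory.Prime_Powers"
    "HOL-Number_Theory.Modular_Inverse"
    "Graph_Theory.Pair_Digraph"
begin

section \<open>Finite fields, characters and Gauss sums\<close>

text \<open>
  All subfields are realised inside one ambient finite field \<open>'a\<close>: its subfield of order
  \<open>Q\<close>, if there is one, is the set of roots of \<open>x ^ Q = x\<close>.  If \<open>Q\<close> is the order of \<open>'a\<close>, this is
  all of \<open>'a\<close>.
\<close>

definition GF_sub :: "nat \<Rightarrow> 'a::finite_field set" where
  "GF_sub Q = {x. x ^ Q = x}"

definition primitive_element :: "'a::finite_field \<Rightarrow> bool" where
  "primitive_element g \<longleftrightarrow> range (\<lambda>k::nat. g ^ k) = - {0}"

text \<open>The trace from the subfield of order \<open>Q = p ^ e\<close> to the prime field; the exponent \<open>e\<close>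
  is recovered from \<open>Q\<close> as a multiplicity.\<close>

definition abs_trace :: "nat \<Rightarrow> 'a::finite_field \<Rightarrow> 'a" where
  "abs_trace Q x = (\<Sum>i<multiplicity CHAR('a) Q. x ^ (CHAR('a) ^ i))"

text \<open>The representative in \<open>{0..<p}\<close> of an element of the prime field.\<close>

definition prime_field_rep :: "'a::finite_field \<Rightarrow> nat" where
  "prime_field_rep t = (THE j. j < CHAR('a) \<and> of_nat j = t)"

definition add_char :: "nat \<Rightarrow> 'a::finite_field \<Rightarrow> complex" where
  "add_char Q x =
     exp (2 * of_real pi * \<i> * of_nat (prime_field_rep (abs_trace Q x)) / of_nat CHAR('a))"

definition add_char_sum :: "nat \<Rightarrow> 'a::finite_field set \<Rightarrow> complex" where
  "add_char_sum Q A = (\<Sum>x\<in>A. add_char Q x)"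

definition gauss_sum :: "nat \<Rightarrow> ('a::finite_field \<Rightarrow> complex) \<Rightarrow> complex" where
  "gauss_sum Q \<chi> = (\<Sum>x\<in>GF_sub Q - {0}. \<chi> x * add_char Q x)"

definition quadratic_char :: "nat \<Rightarrow> 'a::finite_field \<Rightarrow> complex" where
  "quadratic_char Q x =
     (if x = 0 then 0 else if \<exists>y\<in>GF_sub Q. x = y ^ 2 then 1 else - 1)"

section \<open>Cyclotomic classes and index sets\<close>

text \<open>
  The coset \<open>g ^ i \<langle>g ^ K\<rangle>\<close>, where \<open>g\<close> is a primitive element of the field under
  consideration; \<open>g\<close> determines which field that is.
\<close>

definition cyclotomic_class :: "'a::finite_field \<Rightarrow> nat \<Rightarrow> int \<Rightarrow> 'a set" where
  "cyclotomic_class g K i = range (\<lambda>j::int. g powi i * (g ^ K) powi j)"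

text \<open>Subsets of the integers modulo \<open>N\<close> are represented by subsets of \<open>{0..<int N}\<close>.\<close>

definition gauss_period_level :: "'a::finite_field \<Rightarrow> nat \<Rightarrow> nat \<Rightarrow> rat \<Rightarrow> int set" where
  "gauss_period_level w Q N \<alpha> =
     {i \<in> {0..<int N}. add_char_sum Q (cyclotomic_class w N i) = of_rat \<alpha>}"

definition inv_scale :: "nat \<Rightarrow> int \<Rightarrow> int set \<Rightarrow> int set" where
  "inv_scale N a I = (\<lambda>i. (modular_inverse (int N) a * i) mod int N) ` I"

definition X_index :: "nat \<Rightarrow> int set \<Rightarrow> int set \<Rightarrow> int set" where
  "X_index N S1 S2 =
     (\<lambda>j. (2 * j) mod (2 * int N)) ` inv_scale N 4 S1 \<union>
     (\<lambda>j. (2 * j + int N) mod (2 * int N)) ` inv_scale N 4 S2"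

definition Y_index :: "nat \<Rightarrow> int set \<Rightarrow> int set \<Rightarrow> int set \<Rightarrow> int set" where
  "Y_index N I1 S1 S2 =
     (\<lambda>(i, j). (int N * i + 4 * j) mod (4 * int N)) `
       ({0, 3} \<times> inv_scale N 4 S1 \<union> {1, 2} \<times> inv_scale N 4 S2 \<union>
        {0, 1, 2, 3} \<times> inv_scale N 4 I1)"

definition D_set ::
  "'a::finite_field \<Rightarrow> nat \<Rightarrow> int set \<Rightarrow> int set \<Rightarrow> int set \<Rightarrow> 'a set" where
  "D_set g N I1 S1 S2 = (\<Union>i\<in>Y_index N I1 S1 S2. cyclotomic_class g (4 * N) i)"

section \<open>Strongly regular Cayley graphs\<close>

definition Cay :: "'a::group_add set \<Rightarrow> 'a pair_pre_digraph" where
  "Cay D = \<lparr> pverts = UNIV, parcs = {(x, y). x - y \<in> D} \<rparr>"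

text \<open>
  A \<open>pair_graph\<close> is a finite simple graph, each edge being stored as two opposite arcs.
  The parameters are integers, so that expressions such as \<open>- n + r\<^sup>2 + 3 * r\<close> are not
  truncated.
\<close>

definition strongly_regular ::
  "'a pair_pre_digraph \<Rightarrow> int \<Rightarrow> int \<Rightarrow> int \<Rightarrow> int \<Rightarrow> bool" where
  "strongly_regular G v k l \<mu> \<longleftrightarrow>
     pair_graph G \<and>
     int (card (pverts G)) = v \<and>
     (\<forall>x\<in>pverts G. int (card {y. (x, y) \<in> parcs G}) = k) \<and>
     (\<forall>x\<in>pverts G. \<forall>y\<in>pverts G. x \<noteq> y \<longrightarrow>
        int (card {z. (x, z) \<in> parcs G \<and> (y, z) \<in> parcs G}) =
          (if (x, y) \<in> parcs G then l else \<mu>))"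

definition negative_latin_square_type :: "'a pair_pre_digraph \<Rightarrow> bool" where
  "negative_latin_square_type G \<longleftrightarrow>
     (\<exists>n r :: nat. strongly_regular G ((int n)\<^sup>2) (int r * (int n + 1))
        (- int n + (int r)\<^sup>2 + 3 * int r) ((int r)\<^sup>2 + int r))"

end

theory Submission
  imports Defs "HOL-Number_Theory.Residues" "HOL-Computational_Algebra.Polynomial"
begin

text \<open>
  Write \<open>Q = q ^ m\<close>, let \<open>nm\<close> and \<open>tr\<close> be the norm and trace onto the subfield \<open>F\<close> of order \<open>Q\<close>, and let \<open>P\<close>
  be the Gauss period as a function of the class modulo \<open>N\<close>.  Twice the indicator of \<open>D\<close> is
  \<open>(2 1\<^bsub>I1\<^esub> + 1\<^bsub>I2\<^esub>) + \<chi> (1\<^bsub>S1\<^esub> - 1\<^bsub>S2\<^esub>)\<close>, where \<open>\<chi>\<close> is a sign on the classes modulo \<open>4\<close> with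
  \<open>\<chi>(k + 2) = - \<chi>(k)\<close>.

  Because the three periods are equally spaced, the first summand is affine in \<open>P\<close>.  As \<open>P\<close> is a sum of
  functions \<open>\<psi>(u nm(x))\<close>, completing the square shows that it is an eigenfunction of the Fourier transform
  with eigenvalue \<open>- Q\<close>; so the first summand transforms to \<open>2 r - Q (2 1\<^bsub>I1\<^esub> + 1\<^bsub>I2\<^esub>)\<close>.

  In the transform of the second summand, averaging over conjugation \<open>x \<mapsto> x\<^sup>Q\<close> leaves only squares
  \<open>x = z u\<close> with \<open>z \<in> F\<close> and \<open>nm u = 1\<close>.  On the norm-one group the remaining sign is \<open>\<eta>(tr u + 2)\<close>, which
  turns the sum over \<open>u\<close> into a sum over \<open>F\<close> and produces \<open>\<plusminus> G(\<eta>)\<close> times the sum that the hypothesis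
  evaluates.  Since \<open>G(\<eta>)\<^sup>2 = - Q\<close>, the second summand transforms to \<open>\<plusminus> Q\<close> on \<open>I2\<close> and to \<open>0\<close> elsewhere.
\<close>

section \<open>Quadratic extensions of finite fields\<close>

locale quadratic_extension =
  fixes \<gamma> :: "'a::finite_field" and Q n :: nat
  assumes primitive: "primitive_element \<gamma>"
    and card_UNIV: "card (UNIV :: 'a set) = Q\<^sup>2"
    and Q_eq: "Q = CHAR('a) ^ n"
    and Q_mod_4: "Q mod 4 = 3"
begin

definition \<omega> :: 'a where "\<omega> = \<gamma> ^ (Q + 1)"
abbreviation F :: "'a set" where "F \<equiv> GF_sub Q"
definition tr :: "'a \<Rightarrow> 'a" where "tr x = x + x ^ Q"
definition nm :: "'a \<Rightarrow> 'a" where "nm x = x ^ (Q + 1)"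
abbreviation \<psi> :: "'a \<Rightarrow> complex" where "\<psi> \<equiv> add_char Q"
abbreviation \<eta> :: "'a \<Rightarrow> complex" where "\<eta> \<equiv> quadratic_char Q"
text \<open>Discrete logarithms to the bases \<open>\<gamma>\<close> and \<open>\<omega>\<close>: defined only modulo the group order, and
  meaningless at \<open>0\<close>, respectively outside \<open>F - {0}\<close>.\<close>

definition ind :: "'a \<Rightarrow> int" where "ind x = (SOME k. \<gamma> powi k = x)"
definition indF :: "'a \<Rightarrow> int" where "indF x = (SOME k. \<omega> powi k = x)"

lemma Q_ge_3: "Q \<ge> 3" and odd_Q: "odd Q" and Q_pos: "Q > 0"
  using Q_mod_4 by presburger+

lemma four_dvd: "4 dvd Q + 1"
  using Q_mod_4 by presburger

lemma card_units: "int (Q\<^sup>2 - 1) = int (Q - 1) * int (Q + 1)"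
proof -
  have "Q\<^sup>2 - 1 = (Q - 1) * (Q + 1)"
    by (simp add: power2_eq_square algebra_simps)
  then show ?thesis by (simp only: of_nat_mult)
qed

lemma even_Q_minus_1: "even (int (Q - 1))"
  using odd_Q Q_pos by simp

lemma power_card: "x ^ (Q\<^sup>2) = (x :: 'a)"
  using finite_field_power_card_eq_same[of x] by (simp add: card_UNIV)

lemma gamma_nonzero [simp]: "\<gamma> \<noteq> 0"
proof
  assume "\<gamma> = 0"
  then have "\<gamma> ^ 1 \<in> - {0 :: 'a} \<Longrightarrow> False" by simp
  moreover have "\<gamma> ^ 1 \<in> - {0 :: 'a}"
    using primitive unfolding primitive_element_def by blast
  ultimately show False by blast
qed

lemma power_units: "x \<noteq> 0 \<Longrightarrow> x ^ (Q\<^sup>2 - 1) = (1 :: 'a)"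
proof -
  assume x: "x \<noteq> 0"
  have "x * x ^ (Q\<^sup>2 - 1) = x ^ (Q\<^sup>2)"
    using Q_pos by (subst power_Suc[symmetric]) simp
  then show ?thesis using x power_card[of x] by simp
qed

section \<open>Discrete logarithms in the multiplicative group of the large field\<close>

lemma powi_mod_order: "\<gamma> powi k = \<gamma> powi (k mod int (Q\<^sup>2 - 1))"
proof -
  have "\<gamma> powi k = \<gamma> powi (int (Q\<^sup>2 - 1) * (k div int (Q\<^sup>2 - 1)) + k mod int (Q\<^sup>2 - 1))"
    by simp
  also have "\<dots> = (\<gamma> ^ (Q\<^sup>2 - 1)) powi (k div int (Q\<^sup>2 - 1)) * \<gamma> powi (k mod int (Q\<^sup>2 - 1))"
    by (subst power_int_add) (simp_all only: power_int_mult power_int_of_nat gamma_nonzero simp_thms)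
  also have "\<dots> = \<gamma> powi (k mod int (Q\<^sup>2 - 1))"
    by (subst power_units) simp_all
  finally show ?thesis .
qed

lemma range_gamma: "range (\<lambda>k::int. \<gamma> powi k) = - {0}"
proof
  show "- {0} \<subseteq> range (\<lambda>k::int. \<gamma> powi k)"
  proof
    fix x :: 'a assume "x \<in> - {0}"
    then obtain k :: nat where "x = \<gamma> ^ k"
      using primitive unfolding primitive_element_def by blast
    then show "x \<in> range (\<lambda>k::int. \<gamma> powi k)"
      by (intro image_eqI[of _ _ "int k"]) simp_all
  qed
qed auto

text \<open>The exponents below \<open>Q\<^sup>2 - 1\<close> already produce all nonzero elements,
  and there are exactly that many of these. A surjection between finite sets of equal size is
  injective, so \<gamma> has this exact order.\<close>

lemma gamma_powi_eq_iff: "\<gamma> powi a = \<gamma> powi b \<longleftrightarrow> [a = b] (mod int (Q\<^sup>2 - 1))"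
proof -
  let ?M = "int (Q\<^sup>2 - 1)"
  have "1 < Q\<^sup>2" using Q_ge_3 by (intro one_less_power) auto
  then have "0 < Q\<^sup>2 - 1" by simp
  then have M: "?M > 0" by (simp only: of_nat_0_less_iff)
  have "(\<lambda>k. \<gamma> powi k) ` {0..<?M} = range (\<lambda>k::int. \<gamma> powi k)"
  proof
    show "range (\<lambda>k::int. \<gamma> powi k) \<subseteq> (\<lambda>k. \<gamma> powi k) ` {0..<?M}"
    proof
      fix x assume "x \<in> range (\<lambda>k::int. \<gamma> powi k)"
      then obtain k where "x = \<gamma> powi k" by blast
      then have "x = \<gamma> powi (k mod ?M)" using powi_mod_order by metis
      then show "x \<in> (\<lambda>k. \<gamma> powi k) ` {0..<?M}"
        using M pos_mod_sign[of ?M k] pos_mod_bound[of ?M k] by (metis atLeastLessThan_iff image_eqI)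
    qed
  qed auto
  then have "card ((\<lambda>k. \<gamma> powi k) ` {0..<?M}) = card (- {0 :: 'a})"
    by (simp add: range_gamma)
  also have "\<dots> = card {0..<?M}"
    by (simp add: Compl_eq_Diff_UNIV card_Diff_subset card_UNIV)
  finally have inj: "inj_on (\<lambda>k. \<gamma> powi k) {0..<?M}"
    by (intro eq_card_imp_inj_on) auto
  have "\<gamma> powi a = \<gamma> powi b \<longleftrightarrow> \<gamma> powi (a mod ?M) = \<gamma> powi (b mod ?M)"
    using powi_mod_order by metis
  also have "\<dots> \<longleftrightarrow> a mod ?M = b mod ?M"
    using M by (intro inj_on_eq_iff[OF inj])
      (simp_all only: atLeastLessThan_iff pos_mod_sign pos_mod_bound simp_thms)
  finally show ?thesis by (simp add: cong_def)
qed

lemma ind_powi: "x \<noteq> 0 \<Longrightarrow> \<gamma> powi (ind x) = x"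
proof -
  assume "x \<noteq> 0"
  then have "x \<in> range (\<lambda>k::int. \<gamma> powi k)" using range_gamma by auto
  then have "\<exists>k. \<gamma> powi k = x" by auto
  then show ?thesis unfolding ind_def by (rule someI_ex)
qed

lemma omega_nonzero [simp]: "\<omega> \<noteq> 0"
  by (simp add: \<omega>_def)

lemma omega_powi: "\<omega> powi k = \<gamma> powi (int (Q + 1) * k)"
  by (simp only: \<omega>_def power_int_power)

text \<open>The factor Q + 1 in the exponent of \<gamma> cancels against (Q - 1)(Q + 1), the order
  of \<gamma>.\<close>

lemma omega_powi_eq_iff: "\<omega> powi a = \<omega> powi b \<longleftrightarrow> [a = b] (mod int (Q - 1))"
  unfolding omega_powi gamma_powi_eq_iff card_units
  by (metis cong_iff_dvd_diff dvd_times_right_cancel_iff mult.commute of_nat_0_less_iff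
      order_less_irrefl right_diff_distrib zero_less_Suc Suc_eq_plus1)

section \<open>The Frobenius map \<open>x ^ Q\<close> and its fixed field \<open>F\<close>\<close>

lemma power_Q_add: "(x + y :: 'a) ^ Q = x ^ Q + y ^ Q"
  by (rule freshmans_dream') (simp_all add: Q_eq)

lemma minus_power_Q: "(- x :: 'a) ^ Q = - (x ^ Q)"
  using odd_Q by simp

lemma diff_power_Q: "(x - y :: 'a) ^ Q = x ^ Q - y ^ Q"
  using power_Q_add[of x "- y"] by (simp add: minus_power_Q)

lemma power_Q_Q: "(x ^ Q) ^ Q = (x :: 'a)"
  using power_card[of x] by (simp add: power2_eq_square power_mult)

lemma mem_F_iff: "x \<in> F \<longleftrightarrow> x ^ Q = x"
  by (simp add: GF_sub_def)

lemma F_0 [simp]: "0 \<in> F" and F_1 [simp]: "1 \<in> F"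
  using Q_pos by (simp_all add: mem_F_iff)

lemma F_add: "x \<in> F \<Longrightarrow> y \<in> F \<Longrightarrow> x + y \<in> F"
  and F_diff: "x \<in> F \<Longrightarrow> y \<in> F \<Longrightarrow> x - y \<in> F"
  and F_mult: "x \<in> F \<Longrightarrow> y \<in> F \<Longrightarrow> x * y \<in> F"
  and F_divide: "x \<in> F \<Longrightarrow> y \<in> F \<Longrightarrow> x / y \<in> F"
  and F_minus: "x \<in> F \<Longrightarrow> - x \<in> F"
  and F_power: "x \<in> F \<Longrightarrow> x ^ k \<in> F"
  by (simp_all add: mem_F_iff power_Q_add diff_power_Q power_mult_distrib power_divide
      minus_power_Q power_commutes power_mult[symmetric])
     (metis mult.commute power_mult)

lemma F_of_nat: "of_nat k \<in> F"
  by (induction k) (auto intro: F_add)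

lemma F_numeral: "numeral k \<in> F"
  using F_of_nat[of "numeral k"] by simp

text \<open>Being fixed by Frobenius means that (Q - 1)(Q + 1) divides (Q - 1) k, and Q - 1
  cancels.\<close>

lemma gamma_powi_in_F_iff: "\<gamma> powi k \<in> F \<longleftrightarrow> int (Q + 1) dvd k"
proof -
  have "\<gamma> powi k \<in> F \<longleftrightarrow> \<gamma> powi (int Q * k) = \<gamma> powi k"
    by (simp add: mem_F_iff power_int_power' mult.commute)
  also have "\<dots> \<longleftrightarrow> int (Q - 1) * int (Q + 1) dvd int Q * k - k"
    by (simp only: gamma_powi_eq_iff card_units cong_iff_dvd_diff)
  also have "int Q * k - k = int (Q - 1) * k"
    using Q_pos by (simp add: of_nat_diff left_diff_distrib)
  also have "int (Q - 1) * int (Q + 1) dvd int (Q - 1) * k \<longleftrightarrow> int (Q + 1) dvd k"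
    using Q_ge_3 by (subst dvd_mult_cancel_left) auto
  finally show ?thesis .
qed

lemma omega_powi_in_F: "\<omega> powi k \<in> F"
  unfolding omega_powi gamma_powi_in_F_iff by simp

lemma indF_powi: "x \<in> F \<Longrightarrow> x \<noteq> 0 \<Longrightarrow> \<omega> powi (indF x) = x"
proof -
  assume x: "x \<in> F" "x \<noteq> 0"
  then have "int (Q + 1) dvd ind x"
    using gamma_powi_in_F_iff ind_powi by metis
  then obtain k where "ind x = int (Q + 1) * k" by blast
  then have "\<omega> powi k = x" using omega_powi ind_powi x by metis
  then show ?thesis unfolding indF_def by (rule someI)
qed

lemma ind_cong: "x \<noteq> 0 \<Longrightarrow> x = \<gamma> powi k \<longleftrightarrow> [ind x = k] (mod int (Q\<^sup>2 - 1))"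
  using ind_powi gamma_powi_eq_iff by metis

lemma indF_cong: "x \<in> F \<Longrightarrow> x \<noteq> 0 \<Longrightarrow> x = \<omega> powi k \<longleftrightarrow> [indF x = k] (mod int (Q - 1))"
  using indF_powi omega_powi_eq_iff by metis

lemma ind_mult: "x \<noteq> 0 \<Longrightarrow> y \<noteq> 0 \<Longrightarrow> [ind (x * y) = ind x + ind y] (mod int (Q\<^sup>2 - 1))"
  by (subst ind_cong[symmetric]) (auto simp: power_int_add ind_powi)

lemma ind_divide: "x \<noteq> 0 \<Longrightarrow> y \<noteq> 0 \<Longrightarrow> [ind (x / y) = ind x - ind y] (mod int (Q\<^sup>2 - 1))"
  by (subst ind_cong[symmetric]) (auto simp: power_int_diff ind_powi)

lemma ind_power: "x \<noteq> 0 \<Longrightarrow> [ind (x ^ k) = int k * ind x] (mod int (Q\<^sup>2 - 1))"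
  by (subst ind_cong[symmetric]) (simp, metis ind_powi power_int_power' mult.commute)

lemma indF_mult:
  "x \<in> F - {0} \<Longrightarrow> y \<in> F - {0} \<Longrightarrow> [indF (x * y) = indF x + indF y] (mod int (Q - 1))"
  by (subst indF_cong[symmetric]) (auto simp: power_int_add indF_powi F_mult)

lemma indF_power: "x \<in> F - {0} \<Longrightarrow> [indF (x ^ k) = int k * indF x] (mod int (Q - 1))"
  by (subst indF_cong[symmetric]) (auto simp: F_power, metis indF_powi power_int_power' mult.commute)

lemma indF_divide:
  "x \<in> F - {0} \<Longrightarrow> y \<in> F - {0} \<Longrightarrow> [indF (x / y) = indF x - indF y] (mod int (Q - 1))"
  by (subst indF_cong[symmetric]) (auto simp: power_int_diff indF_powi F_divide)

lemma indF_omega: "[indF (\<omega> powi k) = k] (mod int (Q - 1))"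
  by (subst indF_cong[symmetric]) (auto simp: omega_powi_in_F)

lemma nm_mult: "nm (x * y) = nm x * nm y" and nm_divide: "nm (x / y) = nm x / nm y"
  by (simp_all add: nm_def power_mult_distrib power_divide)

lemma nm_eq_0_iff [simp]: "nm x = 0 \<longleftrightarrow> x = 0"
  by (auto simp: nm_def)

lemma nm_in_F [simp]: "nm x \<in> F"
  by (simp add: nm_def mem_F_iff power_mult_distrib power_Q_Q mult.commute)

lemma nm_powi: "nm (\<gamma> powi k) = \<omega> powi k"
  unfolding nm_def omega_powi power_int_power' by (simp only: mult.commute)

text \<open>The norm sends \<open>\<gamma> powi k\<close> to \<open>\<omega> powi k\<close>, so it
  preserves logarithms modulo Q - 1. For N dividing Q - 1, functions of the class modulo N in the
  large field thereby become functions of the norm.\<close>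

lemma indF_nm: "x \<noteq> 0 \<Longrightarrow> [indF (nm x) = ind x] (mod int (Q - 1))"
  by (subst indF_cong[symmetric]) (auto simp: ind_powi simp flip: nm_powi)

lemma tr_in_F [simp]: "tr x \<in> F"
  by (simp add: tr_def mem_F_iff power_Q_add power_Q_Q add.commute)

lemma tr_add: "tr (x + y) = tr x + tr y"
  by (simp add: tr_def power_Q_add)

lemma tr_scale: "z \<in> F \<Longrightarrow> tr (z * x) = z * tr x"
  by (simp add: tr_def power_mult_distrib mem_F_iff algebra_simps)

end

section \<open>The additive and the quadratic character\<close>

lemma power_cong_order:
  fixes z :: "'b::monoid_mult"
  assumes "z ^ p = 1" and "[a = b] (mod p)"
  shows "z ^ a = z ^ b"
proof -
  have "z ^ k = z ^ (k mod p)" for k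
  proof -
    have "z ^ k = z ^ (p * (k div p) + k mod p)" by simp
    also have "\<dots> = z ^ (k mod p)"
      unfolding power_add power_mult by (simp add: assms(1))
    finally show ?thesis .
  qed
  then show ?thesis using assms(2) by (metis cong_def)
qed

text \<open>The polynomial X^p - X has at most p roots, and the p distinct multiples of 1 are roots.
  Hence every t with t^p = t is a unique such multiple, and the description in
  \<open>prime_field_rep\<close> is well defined.\<close>

lemma prime_field_rep:
  fixes t :: "'a::finite_field"
  assumes "t ^ CHAR('a) = t"
  shows "prime_field_rep t < CHAR('a)" and "of_nat (prime_field_rep t) = t"
proof -
  let ?p = "CHAR('a)"
  have p: "prime ?p" by simp
  then have p1: "?p > 1" by (rule prime_gt_1_nat)
  define P :: "'a poly" where "P = monom 1 ?p - monom 1 1"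
  have cP: "coeff P ?p = 1" using p1 by (simp add: P_def)
  then have P0: "P \<noteq> 0" by auto
  have deg: "degree P \<le> ?p"
    unfolding P_def using p1 by (intro degree_diff_le) (auto simp: degree_monom_eq)
  have roots: "{x. poly P x = 0} = {x. x ^ ?p = x}"
    by (auto simp: P_def poly_monom)
  have card: "card {x :: 'a. x ^ ?p = x} \<le> ?p"
    using card_poly_roots_bound[OF P0] deg by (simp add: roots)
  have inj: "inj_on (of_nat :: nat \<Rightarrow> 'a) {..<?p}"
    by (auto simp: inj_on_def of_nat_eq_iff_cong_CHAR cong_def)
  have sub: "of_nat ` {..<?p} \<subseteq> {x :: 'a. x ^ ?p = x}"
  proof safe
    fix k show "(of_nat k :: 'a) ^ ?p = of_nat k"
    proof (induction k)
      case 0 then show ?case using p1 by simp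
    next
      case (Suc k) then show ?case by (simp add: freshmans_dream)
    qed
  qed
  have "of_nat ` {..<?p} = {x :: 'a. x ^ ?p = x}"
    using card sub card_image[OF inj] by (intro card_seteq) auto
  then have "t \<in> of_nat ` {..<?p}" using assms by simp
  then obtain j where j: "t = of_nat j" "j < ?p" by (elim imageE) simp
  have "\<exists>!j. j < ?p \<and> of_nat j = t"
  proof (rule ex1I[of _ j])
    fix i assume i: "i < ?p \<and> of_nat i = t"
    then have "(of_nat i :: 'a) = of_nat j" using j by simp
    then show "i = j" using inj i j(2) by (meson inj_onD lessThan_iff)
  qed (use j in simp)
  from theI'[OF this] show "prime_field_rep t < ?p" "of_nat (prime_field_rep t) = t"
    by (simp_all add: prime_field_rep_def)
qed

context quadratic_extension
begin

section \<open>Traces to the prime field and the additive character\<close>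

lemma multiplicity_Q: "multiplicity CHAR('a) Q = n" and multiplicity_Q2: "multiplicity CHAR('a) (Q\<^sup>2) = n + n"
proof -
  have "prime CHAR('a)" by simp
  then show "multiplicity CHAR('a) Q = n" "multiplicity CHAR('a) (Q\<^sup>2) = n + n"
    using multiplicity_same_power[of "CHAR('a)"]
    by (simp_all add: Q_eq mult_2_right flip: power_mult)
qed

lemma add_power_CHAR_power: "(x + y :: 'a) ^ (CHAR('a) ^ i) = x ^ (CHAR('a) ^ i) + y ^ (CHAR('a) ^ i)"
  by (rule freshmans_dream') simp_all

lemma abs_trace_add: "abs_trace Q (x + y :: 'a) = abs_trace Q x + abs_trace Q y"
  by (simp add: abs_trace_def add_power_CHAR_power sum.distrib)

text \<open>Transitivity of the trace: of the 2n conjugates of x, the last n are those of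
  \<open>x ^ Q\<close>. With it, characters of the large field become characters of \<open>F\<close>
  evaluated at \<open>tr\<close>.\<close>

lemma abs_trace_square: "abs_trace (Q\<^sup>2) x = abs_trace Q (tr x)"
proof -
  have split: "(\<Sum>i<n + k. f i) = (\<Sum>i<n. f i) + (\<Sum>i<k. f (n + i))" for f :: "nat \<Rightarrow> 'a" and k
    by (induction k) (simp_all add: add.assoc)
  show ?thesis
    by (simp add: abs_trace_def multiplicity_Q multiplicity_Q2 split tr_def add_power_CHAR_power
        sum.distrib power_add power_mult flip: Q_eq)
qed

text \<open>Raising to the power p shifts the conjugates by one place, and x^(p^n) = x closes the
  cycle.\<close>

lemma abs_trace_fixed: "x \<in> F \<Longrightarrow> abs_trace Q x ^ CHAR('a) = (abs_trace Q x :: 'a)"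
proof -
  assume "x \<in> F"
  then have x: "x ^ (CHAR('a) ^ n) = x" by (simp add: mem_F_iff flip: Q_eq)
  have "n > 0" using Q_ge_3 Q_eq by (cases n) auto
  then obtain m where m: "n = Suc m" by (cases n) auto
  have "abs_trace Q x ^ CHAR('a) = (\<Sum>i<n. x ^ (CHAR('a) ^ Suc i))"
    unfolding abs_trace_def multiplicity_Q
    by (subst freshmans_dream_sum) (simp_all add: mult.commute flip: power_mult)
  also have "\<dots> = (\<Sum>i<m. x ^ (CHAR('a) ^ Suc i)) + x"
    using x by (simp only: m sum.lessThan_Suc)
  also have "\<dots> = abs_trace Q x"
    unfolding abs_trace_def multiplicity_Q m by (subst sum.lessThan_Suc_shift) simp
  finally show ?thesis .
qed

lemma psi_eq: "\<psi> x = exp (2 * of_real pi * \<i> / of_nat CHAR('a)) ^ prime_field_rep (abs_trace Q x)"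
  unfolding add_char_def by (subst exp_of_nat_mult[symmetric]) (simp add: field_simps)

text \<open>Representatives of prime field elements add only modulo p, which suffices because exp(2
  \<pi> i / p) is a p-th root of unity. Membership in \<open>F\<close> guarantees that the traces
  lie in the prime field.\<close>

lemma psi_add: "x \<in> F \<Longrightarrow> y \<in> F \<Longrightarrow> \<psi> (x + y) = \<psi> x * \<psi> y"
proof -
  assume x: "x \<in> F" and y: "y \<in> F"
  let ?z = "exp (2 * of_real pi * \<i> / of_nat CHAR('a)) :: complex"
  let ?t = "\<lambda>x. prime_field_rep (abs_trace Q x)"
  have "(of_nat (?t (x + y)) :: 'a) = of_nat (?t x + ?t y)"
    using prime_field_rep(2)[OF abs_trace_fixed[OF x]] prime_field_rep(2)[OF abs_trace_fixed[OF y]]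
      prime_field_rep(2)[OF abs_trace_fixed[OF F_add[OF x y]]]
    by (simp only: abs_trace_add of_nat_add)
  then have c: "[?t (x + y) = ?t x + ?t y] (mod CHAR('a))"
    by (simp only: of_nat_eq_iff_cong_CHAR)
  have "?z ^ CHAR('a) = 1"
    by (subst exp_of_nat_mult[symmetric]) simp
  from power_cong_order[OF this c] show ?thesis
    by (simp add: psi_eq power_add)
qed

lemma psi_nonzero [simp]: "\<psi> x \<noteq> 0"
  by (simp add: psi_eq)

lemma psi_0 [simp]: "\<psi> 0 = 1"
  using psi_add[of 0 0] by simp

lemma add_char_square: "add_char (Q\<^sup>2) x = \<psi> (tr x)"
  by (simp add: add_char_def abs_trace_square)

lemma F_eq_range: "F - {0} = range (\<lambda>k::int. \<omega> powi k)"
proof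
  show "F - {0} \<subseteq> range (\<lambda>k::int. \<omega> powi k)"
  proof
    fix x assume "x \<in> F - {0}"
    then have "x = \<omega> powi (indF x)" by (simp add: indF_powi)
    then show "x \<in> range (\<lambda>k::int. \<omega> powi k)" by (rule range_eqI)
  qed
qed (auto simp: omega_powi_in_F)

lemma card_F_units: "card (F - {0}) = Q - 1"
proof -
  let ?M = "int (Q - 1)"
  have M: "?M > 0" using Q_ge_3 by simp
  have "bij_betw (\<lambda>k. \<omega> powi k) {0..<?M} (F - {0})"
  proof (rule bij_betwI')
    fix x y assume "x \<in> {0..<?M}" "y \<in> {0..<?M}"
    then show "\<omega> powi x = \<omega> powi y \<longleftrightarrow> x = y"
      by (simp add: omega_powi_eq_iff cong_def)
  next
    fix y assume "y \<in> F - {0}"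
    then obtain k where "y = \<omega> powi k" unfolding F_eq_range by blast
    also have "\<omega> powi k = \<omega> powi (k mod ?M)"
      by (simp only: omega_powi_eq_iff cong_mod_right cong_refl)
    finally show "\<exists>x\<in>{0..<?M}. y = \<omega> powi x"
      using M pos_mod_sign[of ?M k] pos_mod_bound[of ?M k] by (metis atLeastLessThan_iff)
  qed (auto simp: omega_powi_in_F)
  then show ?thesis using bij_betw_same_card by fastforce
qed

lemma card_F: "card F = Q"
proof -
  have "card F > 0" using F_0 by (auto simp: card_gt_0_iff simp del: F_0)
  then show ?thesis using card_F_units Q_pos by (simp add: card_Diff_subset)
qed

lemma sum_F_units_scale:
  assumes "c \<in> F - {0}" shows "(\<Sum>z\<in>F - {0}. K (c * z)) = (\<Sum>z\<in>F - {0}. K z)"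
  by (rule sum.reindex_bij_witness[of _ "\<lambda>z. z / c" "\<lambda>z. c * z"])
     (use assms in \<open>auto simp: F_mult F_divide\<close>)

lemma sum_F_shift:
  assumes "c \<in> F" shows "(\<Sum>z\<in>F. K (z + c)) = (\<Sum>z\<in>F. K z)"
  by (rule sum.reindex_bij_witness[of _ "\<lambda>z. z - c" "\<lambda>z. z + c"])
     (use assms in \<open>auto simp: F_add F_diff\<close>)

lemma sum_F_uminus: "(\<Sum>z\<in>F. K (- z)) = (\<Sum>z\<in>F. K z)"
  by (rule sum.reindex_bij_witness[of _ uminus uminus]) (auto simp: F_minus)

lemma sum_units_scale:
  assumes "c \<noteq> (0::'a)" shows "(\<Sum>z\<in>- {0}. K (c * z)) = (\<Sum>z\<in>- {0}. K z)"
  by (rule sum.reindex_bij_witness[of _ "\<lambda>z. z / c" "\<lambda>z. c * z"]) (use assms in auto)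

section \<open>The quadratic character of \<open>F\<close> and the position of -1\<close>

lemma eta_0 [simp]: "\<eta> 0 = 0" by (simp add: quadratic_char_def)

text \<open>Since Q - 1 is even, the parity of \<open>indF z\<close> does not depend on the chosen
  logarithm.\<close>

lemma eta_eq: assumes "z \<in> F - {0}" shows "\<eta> z = (if even (indF z) then 1 else - 1)"
proof -
  have "(\<exists>y\<in>F. z = y\<^sup>2) \<longleftrightarrow> even (indF z)"
  proof
    assume "\<exists>y\<in>F. z = y\<^sup>2"
    then obtain y where y: "y \<in> F" "z = y\<^sup>2" by blast
    then have "[indF z = 2 * indF y] (mod int (Q - 1))"
      using assms indF_power[of y 2] by simp
    then have "[indF z = 2 * indF y] (mod 2)"
      using even_Q_minus_1 by (rule cong_dvd_modulus)
    then show "even (indF z)" by (simp add: cong_def even_iff_mod_2_eq_zero)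
  next
    assume "even (indF z)"
    then obtain k where k: "indF z = 2 * k" by blast
    have "z = \<omega> powi (indF z)" using assms by (simp add: indF_powi)
    then have "z = (\<omega> powi k)\<^sup>2" by (simp add: k power_int_power' mult.commute)
    then show "\<exists>y\<in>F. z = y\<^sup>2" using omega_powi_in_F by blast
  qed
  then show ?thesis using assms by (simp add: quadratic_char_def)
qed

lemma eta_mult: assumes "x \<in> F" "y \<in> F" shows "\<eta> (x * y) = \<eta> x * \<eta> y"
proof (cases "x = 0 \<or> y = 0")
  case False
  then have xy: "x \<in> F - {0}" "y \<in> F - {0}" "x * y \<in> F - {0}" using assms by (auto simp: F_mult)
  have "[indF (x * y) = indF x + indF y] (mod 2)"
    using indF_mult[OF xy(1,2)] even_Q_minus_1 by (rule cong_dvd_modulus)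
  then have "even (indF (x * y)) \<longleftrightarrow> even (indF x + indF y)"
    by (simp add: cong_def even_iff_mod_2_eq_zero)
  then show ?thesis using xy by (simp add: eta_eq)
qed auto

lemma eta_square: "y \<in> F \<Longrightarrow> y \<noteq> 0 \<Longrightarrow> \<eta> (y\<^sup>2) = 1"
  by (auto simp: quadratic_char_def)

lemma eta_cases: "\<eta> z = 0 \<and> z = 0 \<or> \<eta> z = 1 \<or> \<eta> z = - 1"
  by (auto simp: quadratic_char_def)

lemma minus_one_neq_one: "(- 1 :: 'a) \<noteq> 1"
proof
  assume "(- 1 :: 'a) = 1"
  then have "(1 :: 'a) + 1 = 0" by (simp only: neg_eq_iff_add_eq_0)
  then have "(of_nat 2 :: 'a) = 0" by simp
  then have "CHAR('a) dvd 2" by (simp only: of_nat_eq_0_iff_char_dvd)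
  then have "CHAR('a) = 2" using CHAR_prime[where ?'a = 'a] by (meson primes_dvd_imp_eq two_is_prime_nat)
  then have "even Q" using Q_ge_3 by (cases n) (auto simp: Q_eq)
  then show False using odd_Q by simp
qed

lemma two_nonzero [simp]: "(2 :: 'a) \<noteq> 0"
proof
  assume "(2 :: 'a) = 0"
  then have "(1 :: 'a) + 1 = 0" by simp
  then show False using minus_one_neq_one by (simp only: neg_eq_iff_add_eq_0 simp_thms)
qed

lemma eq_minus_self_iff: "x = - x \<longleftrightarrow> x = (0 :: 'a)"
proof -
  have "x = - x \<longleftrightarrow> 2 * x = 0" by (simp only: mult_2 eq_neg_iff_add_eq_0)
  then show ?thesis by simp
qed

text \<open>The square of this power is 1, while the power itself is not 1 because \<gamma> has full
  order.\<close>

lemma gamma_half: "\<gamma> powi (int ((Q\<^sup>2 - 1) div 2)) = - 1"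
proof -
  have ev: "even (Q\<^sup>2 - 1)" using odd_Q Q_pos by simp
  have "1 < Q\<^sup>2" using Q_ge_3 by (intro one_less_power) auto
  then have "0 < Q\<^sup>2 - 1" by simp
  moreover obtain c where c: "Q\<^sup>2 - 1 = 2 * c" using ev by (elim dvdE)
  ultimately have lt: "0 < (Q\<^sup>2 - 1) div 2" "(Q\<^sup>2 - 1) div 2 < Q\<^sup>2 - 1"
    unfolding c by simp_all
  let ?x = "\<gamma> ^ ((Q\<^sup>2 - 1) div 2)"
  have "?x\<^sup>2 = 1" using power_units[of \<gamma>] ev by (simp flip: power_mult)
  moreover have "?x \<noteq> 1"
  proof
    assume "?x = 1"
    then have "\<gamma> powi int ((Q\<^sup>2 - 1) div 2) = \<gamma> powi 0" by simp
    then have "int (Q\<^sup>2 - 1) dvd int ((Q\<^sup>2 - 1) div 2)"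
      unfolding gamma_powi_eq_iff by (simp add: cong_0_iff)
    then show False using lt by (simp only: int_dvd_int_iff) (meson nat_dvd_not_less)
  qed
  ultimately show ?thesis by (simp add: power2_eq_1_iff)
qed

text \<open>With Q + 1 = 4a and Q - 1 = 2b the group order is 8ab, and -1 has logarithm 4ab. So
  negation does not change logarithms modulo 4.\<close>

lemma ind_minus_1: "4 dvd ind (- 1)"
proof -
  obtain a where a: "Q + 1 = 4 * a" using four_dvd by (elim dvdE)
  have "even (Q - 1)" using odd_Q Q_pos by simp
  then obtain b where b: "Q - 1 = 2 * b" by (elim dvdE)
  note ab = a b
  have e: "(Q\<^sup>2 - 1) = 8 * (a * b)"
  proof -
    have "Q\<^sup>2 - 1 = (Q - 1) * (Q + 1)" by (simp add: power2_eq_square algebra_simps)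
    then show ?thesis by (simp only: ab) simp
  qed
  have "[ind (- 1) = int ((Q\<^sup>2 - 1) div 2)] (mod int (Q\<^sup>2 - 1))"
    by (rule ind_cong[THEN iffD1]) (simp, rule gamma_half[symmetric])
  then have "[ind (- 1) = 4 * int (a * b)] (mod 8 * int (a * b))"
    unfolding e by simp
  then have "[ind (- 1) = 4 * int (a * b)] (mod 4)"
    by (rule cong_dvd_modulus) simp
  then show ?thesis by (simp add: cong_def mod_eq_0_iff_dvd)
qed

text \<open>Since Q mod 4 = 3, the number Q div 2 is odd. A root y of -1 would satisfy
  \<open>y ^ Q = - y\<close>, which excludes it from \<open>F\<close>.\<close>

lemma eta_minus_1: "\<eta> (- 1) = - 1"
proof -
  have "\<not> (\<exists>y\<in>F. - 1 = y\<^sup>2)"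
  proof
    assume "\<exists>y\<in>F. - 1 = y\<^sup>2"
    then obtain y where y: "y \<in> F" "y\<^sup>2 = - 1" by metis
    have fixed: "y ^ Q = y" using y by (simp add: mem_F_iff)
    have "Q = 2 * (Q div 2) + 1" "odd (Q div 2)" using Q_mod_4 by presburger+
    moreover have "y ^ (2 * (Q div 2) + 1) = (y\<^sup>2) ^ (Q div 2) * y"
      by (simp add: power_mult)
    ultimately have "y ^ Q = - y" using y(2) by simp
    with fixed have "y = 0" using eq_minus_self_iff[of y] by simp
    then show False using y by simp
  qed
  then show ?thesis by (simp add: quadratic_char_def)
qed

lemma eta_minus: "z \<in> F \<Longrightarrow> \<eta> (- z) = - \<eta> z"
  using eta_mult[of "- 1" z] by (simp add: eta_minus_1 F_minus)

lemma sum_eta: "(\<Sum>z\<in>F - {0}. \<eta> z) = 0"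
proof -
  have "(\<Sum>z\<in>F - {0}. \<eta> z) = (\<Sum>z\<in>F - {0}. \<eta> (- 1 * z))"
    by (rule sum_F_units_scale[symmetric]) (simp add: F_minus)
  also have "\<dots> = - (\<Sum>z\<in>F - {0}. \<eta> z)"
    by (simp add: eta_minus sum_negf)
  finally show ?thesis by simp
qed

lemma card_sqrt: assumes "a \<in> F - {0}" shows "of_nat (card {z \<in> F - {0}. z\<^sup>2 = a}) = 1 + \<eta> a"
proof (cases "\<exists>y\<in>F. a = y\<^sup>2")
  case True
  then obtain y where y: "y \<in> F" "a = y\<^sup>2" "y \<noteq> 0" using assms by auto
  then have set: "{z \<in> F - {0}. z\<^sup>2 = a} = {y, - y}" by (auto simp: power2_eq_iff F_minus)
  have "y \<noteq> - y" using y eq_minus_self_iff by blast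
  then have "card {y, - y} = 2" by (rule card_2_iff[THEN iffD2, OF exI, OF exI, OF conjI[OF refl]])
  moreover have "\<eta> a = 1" using y eta_square by blast
  ultimately show ?thesis unfolding set by simp
next
  case False
  then have set: "{z \<in> F - {0}. z\<^sup>2 = a} = {}" by auto
  have "\<eta> a = - 1" using False assms by (simp add: quadratic_char_def)
  then show ?thesis unfolding set by simp
qed


subsection \<open>Norm and trace\<close>

definition U :: "'a set" where "U = {u. nm u = 1}"

lemma four_dvd_units: "4 dvd int (Q\<^sup>2 - 1)"
  using four_dvd by (simp only: card_units) (metis dvd_mult int_dvd_int_iff of_nat_numeral)

lemma
  shows ind_mult_4: "x \<noteq> 0 \<Longrightarrow> y \<noteq> 0 \<Longrightarrow> [ind (x * y) = ind x + ind y] (mod 4)"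
    and ind_divide_4: "x \<noteq> 0 \<Longrightarrow> y \<noteq> 0 \<Longrightarrow> [ind (x / y) = ind x - ind y] (mod 4)"
    and ind_power_4: "x \<noteq> 0 \<Longrightarrow> [ind (x ^ k) = int k * ind x] (mod 4)"
  using ind_mult ind_divide ind_power four_dvd_units cong_dvd_modulus by blast+

text \<open>The nonzero elements of \<open>F\<close> are powers of
  \<open>\<gamma> ^ (Q + 1)\<close>, and 4 divides Q + 1. Multiplying by them therefore leaves
  logarithms modulo 4 unchanged.\<close>

lemma ind_F: assumes "z \<in> F" "z \<noteq> 0" shows "4 dvd ind z"
proof -
  have "\<gamma> powi (ind z) \<in> F" using assms by (simp add: ind_powi)
  then have "int (Q + 1) dvd ind z" by (simp only: gamma_powi_in_F_iff)
  moreover have "4 dvd int (Q + 1)" using four_dvd by (metis int_dvd_int_iff of_nat_numeral)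
  ultimately show ?thesis by (rule dvd_trans[rotated])
qed

lemma card_units_set: "card (- {0 :: 'a}) = (Q + 1) * (Q - 1)"
proof -
  have "card (- {0 :: 'a}) = Q\<^sup>2 - 1"
    by (simp add: Compl_eq_Diff_UNIV card_Diff_subset card_UNIV)
  then show ?thesis by (simp add: power2_eq_square algebra_simps)
qed

lemma nm_surj: assumes "z \<in> F - {0}" obtains x where "x \<noteq> 0" "nm x = z"
proof
  show "\<gamma> powi (indF z) \<noteq> 0" by simp
  show "nm (\<gamma> powi (indF z)) = z" using assms by (simp add: nm_powi indF_powi)
qed

text \<open>The fibres of the norm are the cosets of \<open>U\<close>. The size of \<open>U\<close>
  is left open here, because \<open>card_U\<close> obtains it from this lemma with a constant
  summand.\<close>

lemma sum_nm_card_U: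
  fixes K :: "'a \<Rightarrow> complex"
  shows "(\<Sum>x\<in>- {0}. K (nm x)) = of_nat (card U) * (\<Sum>z\<in>F - {0}. K z)"
proof -
  have fibre: "card {x \<in> - {0}. nm x = z} = card U" if z: "z \<in> F - {0}" for z
  proof -
    obtain w where w: "w \<noteq> 0" "nm w = z" using nm_surj[OF z] .
    have "bij_betw (\<lambda>u. w * u) U {x \<in> - {0}. nm x = z}"
      by (rule bij_betw_byWitness[where f' = "\<lambda>x. x / w"])
         (use w in \<open>auto simp: U_def nm_mult nm_divide\<close>, auto simp: nm_def)
    then show ?thesis by (rule bij_betw_same_card[symmetric])
  qed
  have "(\<Sum>x\<in>- {0}. K (nm x)) = (\<Sum>z\<in>F - {0}. \<Sum>x\<in>{x \<in> - {0}. nm x = z}. K (nm x))"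
    by (rule sum.group[symmetric]) auto
  also have "\<dots> = (\<Sum>z\<in>F - {0}. of_nat (card U) * K z)"
  proof (rule sum.cong[OF refl])
    fix z assume z: "z \<in> F - {0}"
    have "(\<Sum>x\<in>{x \<in> - {0}. nm x = z}. K (nm x)) = (\<Sum>x\<in>{x \<in> - {0}. nm x = z}. K z)"
      by (rule sum.cong) auto
    then show "(\<Sum>x\<in>{x \<in> - {0}. nm x = z}. K (nm x)) = of_nat (card U) * K z"
      by (simp only: sum_constant fibre[OF z])
  qed
  finally show ?thesis by (simp add: sum_distrib_left)
qed

lemma card_U: "card U = Q + 1"
proof -
  have "of_nat (card (- {0 :: 'a})) = (of_nat (card U * (Q - 1)) :: complex)"
    using sum_nm_card_U[of "\<lambda>_. 1"] by (simp add: card_F_units)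
  then have "(Q + 1) * (Q - 1) = card U * (Q - 1)"
    unfolding card_units_set by (simp only: of_nat_eq_iff)
  then have "Q + 1 = card U \<or> Q - 1 = 0" by (simp only: mult_cancel2)
  then show ?thesis using Q_ge_3 by auto
qed

lemma sum_nm:
  "(\<Sum>x\<in>- {0}. K (nm x)) = of_nat (Q + 1) * (\<Sum>z\<in>F - {0}. K z :: complex)"
  by (simp only: sum_nm_card_U card_U)

text \<open>A factorisation x = z u with z in \<open>F\<close> and u in \<open>U\<close> is
  determined by z, and it exists exactly when z^2 is the norm of x. Thus x is reached as often as
  its norm has square roots in \<open>F\<close>.\<close>

lemma sum_products:
  fixes K :: "'a \<Rightarrow> complex"
  shows "(\<Sum>z\<in>F - {0}. \<Sum>u\<in>U. K (z * u)) = (\<Sum>x\<in>- {0}. (1 + \<eta> (nm x)) * K x)"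
proof -
  have "(\<Sum>u\<in>U. K (z * u)) = (\<Sum>x\<in>- {0}. if z\<^sup>2 = nm x then K x else 0)" if z: "z \<in> F - {0}" for z
  proof -
    have nz: "nm z = z\<^sup>2" using z by (simp add: nm_def mem_F_iff power2_eq_square)
    have "(\<Sum>u\<in>U. K (z * u)) = (\<Sum>x\<in>{x \<in> - {0}. z\<^sup>2 = nm x}. K x)"
      by (rule sum.reindex_bij_witness[of _ "\<lambda>x. x / z" "\<lambda>u. z * u"])
         (use z nz in \<open>auto simp: U_def nm_mult nm_divide\<close>, auto simp: nm_def)
    also have "\<dots> = (\<Sum>x\<in>- {0}. if z\<^sup>2 = nm x then K x else 0)"
      by (rule sum.inter_filter) simp
    finally show ?thesis .
  qed
  then have "(\<Sum>z\<in>F - {0}. \<Sum>u\<in>U. K (z * u)) = (\<Sum>z\<in>F - {0}. \<Sum>x\<in>- {0}. if z\<^sup>2 = nm x then K x else 0)"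
    by (rule sum.cong[OF refl])
  also have "\<dots> = (\<Sum>x\<in>- {0}. \<Sum>z\<in>F - {0}. if z\<^sup>2 = nm x then K x else 0)"
    by (rule sum.swap)
  also have "\<dots> = (\<Sum>x\<in>- {0}. (1 + \<eta> (nm x)) * K x)"
    by (rule sum.cong[OF refl]) (simp add: card_sqrt[symmetric] flip: sum.inter_filter)
  finally show ?thesis .
qed

text \<open>Logarithms of nonzero elements of \<open>F\<close> are even, so a root b exists in the
  large field. As b^2 is fixed by Frobenius, b is fixed or negated.\<close>

lemma root_of_F_element:
  assumes "a \<in> F" obtains b where "b\<^sup>2 = a" and "b ^ Q = b \<or> b ^ Q = - b"
proof (cases "a = 0")
  case True
  show ?thesis by (rule that[of 0]) (use True Q_pos in auto)
next
  case False
  then have "even (ind a)" using ind_F[OF assms] by (auto elim: dvd_trans[rotated])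
  then obtain k where k: "ind a = 2 * k" by blast
  have sq: "(\<gamma> powi k)\<^sup>2 = a"
    using ind_powi[OF False] by (simp add: k power_int_power' mult.commute)
  have "((\<gamma> powi k) ^ Q)\<^sup>2 = ((\<gamma> powi k)\<^sup>2) ^ Q" by (metis power_mult mult.commute)
  also have "\<dots> = (\<gamma> powi k)\<^sup>2" using sq assms by (simp add: mem_F_iff)
  finally show ?thesis using that[OF sq] by (simp only: power2_eq_iff)
qed

section \<open>Roots negated by Frobenius, and the fibres of the trace on \<open>U\<close>\<close>

lemma eta_anti: assumes "b ^ Q = - b" "b \<noteq> 0" shows "\<eta> (b\<^sup>2) = - 1"
proof -
  have "\<not> (\<exists>y\<in>F. b\<^sup>2 = y\<^sup>2)"
  proof
    assume "\<exists>y\<in>F. b\<^sup>2 = y\<^sup>2"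
    then obtain y where y: "y \<in> F" "b\<^sup>2 = y\<^sup>2" by blast
    then have "b \<in> F" using F_minus by (auto simp: power2_eq_iff)
    then have "b = - b" using assms by (simp add: mem_F_iff)
    then show False using assms eq_minus_self_iff by blast
  qed
  then show ?thesis using assms by (simp add: quadratic_char_def)
qed

text \<open>The counterpart of \<open>card_sqrt\<close>: for nonzero a the two roots are both fixed
  or both negated by Frobenius. For a = 0 the single root 0 counts as negated, in agreement with
  \<eta>(0) = 0.\<close>

lemma card_anti_sqrt: assumes "a \<in> F" shows "of_nat (card {d. d ^ Q = - d \<and> d\<^sup>2 = a}) = 1 - \<eta> a"
proof -
  obtain b where b: "b\<^sup>2 = a" "b ^ Q = b \<or> b ^ Q = - b" using root_of_F_element[OF assms] .
  consider "b = 0" | "b \<noteq> 0" "b ^ Q = b" | "b \<noteq> 0" "b ^ Q = - b" using b by blast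
  then show ?thesis
  proof cases
    case 1
    then have "{d. d ^ Q = - d \<and> d\<^sup>2 = a} = {0}" using b Q_pos by auto
    then show ?thesis using 1 b by auto
  next
    case 2
    have "d \<noteq> b \<and> d \<noteq> - b" if "d ^ Q = - d" for d
    proof -
      have "d = 0 \<or> d ^ Q \<noteq> d" using that eq_minus_self_iff by metis
      moreover have "(- b) ^ Q = - b" using 2 by (simp add: minus_power_Q)
      ultimately show ?thesis using 2 by auto
    qed
    then have set: "{d. d ^ Q = - d \<and> d\<^sup>2 = a} = {}"
      unfolding b(1)[symmetric] power2_eq_iff by blast
    have "\<eta> a = 1" using 2 b eta_square mem_F_iff by blast
    then show ?thesis unfolding set by simp
  next
    case 3
    have "(- b) ^ Q = - (- b)" using 3 by (simp add: minus_power_Q)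
    then have set: "{d. d ^ Q = - d \<and> d\<^sup>2 = a} = {b, - b}"
      unfolding b(1)[symmetric] power2_eq_iff using 3 by blast
    have "b \<noteq> - b" using 3 eq_minus_self_iff by blast
    then have "card {b, - b} = 2" by (rule card_2_iff[THEN iffD2, OF exI, OF exI, OF conjI[OF refl]])
    moreover have "\<eta> a = - 1" using 3 b eta_anti by blast
    ultimately show ?thesis unfolding set by simp
  qed
qed

text \<open>An element of norm 1 and trace s is a root of X^2 - s X + 1 whose conjugate is the other
  root. The map u to 2u - s sends it to a square root of the discriminant that Frobenius
  negates.\<close>

lemma card_U_tr: assumes s: "s \<in> F" shows "of_nat (card {u \<in> U. tr u = s}) = 1 - \<eta> (s\<^sup>2 - 4)"
proof -
  have sQ: "s ^ Q = s" using s by (simp add: mem_F_iff)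
  have two: "(2 :: 'a) ^ Q = 2" using F_numeral by (simp add: mem_F_iff)
  have "bij_betw (\<lambda>u. 2 * u - s) {u \<in> U. tr u = s} {d. d ^ Q = - d \<and> d\<^sup>2 = s\<^sup>2 - 4}"
  proof (rule bij_betw_byWitness[where f' = "\<lambda>d. (d + s) / 2"])
    show "(\<lambda>u. 2 * u - s) ` {u \<in> U. tr u = s} \<subseteq> {d. d ^ Q = - d \<and> d\<^sup>2 = s\<^sup>2 - 4}"
    proof safe
      fix u assume u: "u \<in> U" "s = tr u"
      have uQ: "u ^ Q = tr u - u" by (simp add: tr_def)
      show "(2 * u - tr u) ^ Q = - (2 * u - tr u)"
        using sQ u by (simp add: diff_power_Q power_mult_distrib two uQ algebra_simps)
      have "u * (tr u - u) = 1"
        using u by (simp add: U_def nm_def flip: uQ)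
      then show "(2 * u - tr u)\<^sup>2 = (tr u)\<^sup>2 - 4"
        by (simp add: power2_eq_square algebra_simps)
    qed
    show "(\<lambda>d. (d + s) / 2) ` {d. d ^ Q = - d \<and> d\<^sup>2 = s\<^sup>2 - 4} \<subseteq> {u \<in> U. tr u = s}"
    proof (rule image_subsetI)
      fix d assume "d \<in> {d. d ^ Q = - d \<and> d\<^sup>2 = s\<^sup>2 - 4}"
      then have d: "d ^ Q = - d" "d\<^sup>2 = s\<^sup>2 - 4" by auto
      have Q': "((d + s) / 2) ^ Q = (s - d) / 2"
        using sQ d by (simp add: power_divide two power_Q_add)
      have "(d + s) / 2 * ((s - d) / 2) = (s\<^sup>2 - d\<^sup>2) / (2 * 2)"
        by (simp add: power2_eq_square algebra_simps)
      also have "\<dots> = 4 / (2 * 2)" unfolding d(2) by simp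
      also have "\<dots> = 1"
      proof -
        have "(4 :: 'a) = 2 * 2" by simp
        then show ?thesis using two_nonzero by (metis divide_self mult_eq_0_iff)
      qed
      finally have "nm ((d + s) / 2) = 1" unfolding nm_def by (simp add: Q')
      moreover have "tr ((d + s) / 2) = s"
        unfolding tr_def Q' by (simp add: add_divide_distrib[symmetric])
      ultimately show "(d + s) / 2 \<in> {u \<in> U. tr u = s}" by (simp add: U_def)
    qed
  qed (auto simp: field_simps)
  then have "card {u \<in> U. tr u = s} = card {d. d ^ Q = - d \<and> d\<^sup>2 = s\<^sup>2 - 4}"
    by (rule bij_betw_same_card)
  then show ?thesis
    using card_anti_sqrt[of "s\<^sup>2 - 4"] s by (simp add: F_diff F_power F_numeral)
qed

lemma sum_U_tr:
  fixes K :: "'a \<Rightarrow> complex"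
  shows "(\<Sum>u\<in>U. K (tr u)) = (\<Sum>s\<in>F. (1 - \<eta> (s\<^sup>2 - 4)) * K s)"
proof -
  have "(\<Sum>u\<in>U. K (tr u)) = (\<Sum>s\<in>F. \<Sum>u\<in>{u \<in> U. tr u = s}. K (tr u))"
    by (rule sum.group[symmetric]) auto
  also have "\<dots> = (\<Sum>s\<in>F. (1 - \<eta> (s\<^sup>2 - 4)) * K s)"
    by (rule sum.cong[OF refl]) (simp add: card_U_tr[symmetric])
  finally show ?thesis .
qed

section \<open>The sign of norm-one elements that separates fourth powers from other squares\<close>

definition \<epsilon> :: "'a \<Rightarrow> complex" where "\<epsilon> x = (if 4 dvd ind x then 1 else - 1)"

lemma gamma_half_power: "\<gamma> powi (int (Q + 1) * (int (Q - 1) div 2 * j)) = (if even j then 1 else - 1)"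
proof -
  have "int ((Q\<^sup>2 - 1) div 2) = int (Q\<^sup>2 - 1) div 2" by (simp only: zdiv_int of_nat_numeral)
  also have "\<dots> = int (Q + 1) * (int (Q - 1) div 2)"
    unfolding card_units using even_Q_minus_1 by (simp add: div_mult_swap mult.commute)
  finally have "\<gamma> powi (int (Q + 1) * (int (Q - 1) div 2)) = - 1" using gamma_half by simp
  then have "\<gamma> powi (int (Q + 1) * (int (Q - 1) div 2) * j) = (- 1) powi j"
    by (simp only: power_int_mult)
  then show ?thesis by (simp add: power_int_minus_left mult.assoc)
qed

text \<open>Writing u = w^2 with \<epsilon>(u) = nm(w), the element w + 1/w is a square root of
  tr(u) + 2. It lies in \<open>F\<close> or is negated by Frobenius according to the same
  sign.\<close>

lemma epsilon_U: assumes u: "u \<in> U" "u \<noteq> - 1" shows "\<epsilon> u = \<eta> (tr u + 2)"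
proof -
  have u0: "u \<noteq> 0"
    using u unfolding U_def by (metis mem_Collect_eq nm_eq_0_iff zero_neq_one)
  have "\<omega> powi (ind u) = \<omega> powi 0"
    using nm_powi[of "ind u"] u u0 by (simp add: ind_powi U_def)
  then have "int (Q - 1) dvd ind u" by (simp only: omega_powi_eq_iff cong_0_iff)
  then obtain j where j: "ind u = int (Q - 1) * j" by blast
  define b where "b = int (Q - 1) div 2"
  have b: "int (Q - 1) = 2 * b" using even_Q_minus_1 by (simp add: b_def)
  \<comment> \<open>Here \<open>ind u\<close> is 2 b j. As b is odd because Q mod 4 = 3, this is
    divisible by 4 exactly when j is even.\<close>
  have "odd b" using Q_mod_4 unfolding b_def by (simp add: of_nat_diff) presburger
  then have eps: "\<epsilon> u = (if even j then 1 else - 1)"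
    unfolding \<epsilon>_def j b by (auto simp: mult.assoc dvd_mult_cancel_left[of "2::int" 2, simplified])
  define w where "w = \<gamma> powi (b * j)"
  have w0: "w \<noteq> 0" by (simp add: w_def)
  have wu: "w\<^sup>2 = u"
  proof -
    have "w\<^sup>2 = \<gamma> powi (b * j * int 2)" unfolding w_def by (simp only: power_int_power')
    also have "b * j * int 2 = ind u" unfolding j b by simp
    finally show ?thesis using ind_powi[OF u0] by simp
  qed
  have "nm w = (if even j then 1 else - 1)"
    unfolding w_def nm_def power_int_power' using gamma_half_power[of j]
    by (simp only: b_def mult.commute)
  then have wQ: "w ^ Q = (if even j then 1 else - 1) / w"
    using w0 by (simp add: nm_def field_simps split: if_splits)
  define v where "v = w + 1 / w"
  have uQ: "u ^ Q = 1 / u" using u u0 by (simp add: U_def nm_def field_simps)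
  have v2: "v\<^sup>2 = tr u + 2"
    unfolding tr_def uQ v_def using w0 by (simp add: power2_eq_square field_simps flip: wu)
  \<comment> \<open>Vanishing of v would force the excluded case u = -1, in which \<eta> takes the
    value 0.\<close>
  have v0: "v \<noteq> 0"
  proof
    assume "v = 0"
    then have "w * w + 1 = 0" using w0 by (simp add: v_def field_simps)
    then have "u = - 1" using wu by (simp add: power2_eq_square eq_neg_iff_add_eq_0)
    then show False using u by simp
  qed
  have "v ^ Q = (if even j then v else - v)"
    using w0 unfolding v_def by (auto simp: power_Q_add power_divide wQ)
  then show ?thesis
    using eps v0 eta_square[of v] eta_anti[of v] by (auto simp: mem_F_iff v2 split: if_splits)
qed

text \<open>Counting by traces gives the factor (1 - \<eta>(s^2 - 4)) \<eta>(s + 2), which is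
  \<eta>(s + 2) - \<eta>(s - 2) for s other than -2. Since \<eta> is odd and K is even, the
  substitution of -s for s makes both parts equal, whence the factor 2.\<close>

lemma sum_U_epsilon:
  assumes even: "\<And>s. s \<in> F \<Longrightarrow> K (- s) = K s"
  shows "(\<Sum>u\<in>U. \<epsilon> u * K (tr u)) = 2 * (\<Sum>s\<in>F. \<eta> (s + 2) * K s)"
proof -
  have two: "2 \<in> F" by (rule F_numeral)
  have m1: "- 1 \<in> U" using odd_Q by (simp add: U_def nm_def)
  have tr1: "tr (- 1) = - 2" using odd_Q by (simp add: tr_def)
  have eps1: "\<epsilon> (- 1) = 1" using ind_minus_1 by (simp add: \<epsilon>_def)
  have eta4: "\<eta> (- 2 - 2) = - 1"
  proof -
    have "(- 2 - 2 :: 'a) = - (2\<^sup>2)" by simp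
    then show ?thesis using eta_minus[of "2\<^sup>2"] eta_square[of 2] two by (simp only: F_power two_nonzero) simp
  qed
  \<comment> \<open>The element -1 is split off because \<epsilon> is 1 there, whereas \<eta>(tr(-1)
    + 2) is 0.\<close>
  have "(\<Sum>u\<in>U. \<epsilon> u * K (tr u)) = K (- 2) + (\<Sum>u\<in>U - {- 1}. \<epsilon> u * K (tr u))"
    using m1 by (subst sum.remove[of _ "- 1"]) (auto simp: tr1 eps1)
  also have "(\<Sum>u\<in>U - {- 1}. \<epsilon> u * K (tr u)) = (\<Sum>u\<in>U - {- 1}. \<eta> (tr u + 2) * K (tr u))"
    by (rule sum.cong) (auto simp: epsilon_U)
  also have "\<dots> = (\<Sum>u\<in>U. \<eta> (tr u + 2) * K (tr u))"
    using m1 by (subst (2) sum.remove[of _ "- 1"]) (auto simp: tr1)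
  also have "\<dots> = (\<Sum>s\<in>F. (1 - \<eta> (s\<^sup>2 - 4)) * (\<eta> (s + 2) * K s))"
    by (rule sum_U_tr)
  \<comment> \<open>At s = -2 the left side is 0, but -\<eta>(-4) K(-2) equals K(-2). The correction
    term compensates this, and afterwards it cancels the term split off for u = -1.\<close>
  also have "\<dots> = (\<Sum>s\<in>F. \<eta> (s + 2) * K s - \<eta> (s - 2) * K s - (if s = - 2 then K s else 0))"
  proof (rule sum.cong[OF refl])
    fix s assume s: "s \<in> F"
    show "(1 - \<eta> (s\<^sup>2 - 4)) * (\<eta> (s + 2) * K s) =
        \<eta> (s + 2) * K s - \<eta> (s - 2) * K s - (if s = - 2 then K s else 0)"
    proof (cases "s = - 2")
      case True
      then show ?thesis using eta4 by simp
    next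
      case False
      then have "s + 2 \<noteq> 0" by (simp add: eq_neg_iff_add_eq_0)
      then have sq: "\<eta> (s + 2) * \<eta> (s + 2) = 1" using eta_cases[of "s + 2"] by auto
      have "s\<^sup>2 - 4 = (s - 2) * (s + 2)" by (simp add: power2_eq_square algebra_simps)
      then have "\<eta> (s\<^sup>2 - 4) = \<eta> (s - 2) * \<eta> (s + 2)"
        using s two by (simp add: eta_mult F_add F_diff)
      then have "(1 - \<eta> (s\<^sup>2 - 4)) * (\<eta> (s + 2) * K s) =
          \<eta> (s + 2) * K s - \<eta> (s - 2) * K s * (\<eta> (s + 2) * \<eta> (s + 2))"
        by (simp add: algebra_simps)
      then show ?thesis using False by (simp add: sq)
    qed
  qed
  also have "\<dots> = (\<Sum>s\<in>F. \<eta> (s + 2) * K s) - (\<Sum>s\<in>F. \<eta> (s - 2) * K s) - K (- 2)"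
    using two by (simp add: sum_subtractf F_minus)
  also have "(\<Sum>s\<in>F. \<eta> (s - 2) * K s) = (\<Sum>s\<in>F. \<eta> (- s - 2) * K (- s))"
    by (rule sum_F_uminus[symmetric])
  also have "\<dots> = (\<Sum>s\<in>F. - (\<eta> (s + 2) * K s))"
  proof (rule sum.cong[OF refl])
    fix s assume s: "s \<in> F"
    have "\<eta> (- s - 2) = - \<eta> (s + 2)" using eta_minus[of "s + 2"] s two by (simp add: F_add)
    then show "\<eta> (- s - 2) * K (- s) = - (\<eta> (s + 2) * K s)" using even[OF s] by simp
  qed
  finally show ?thesis by (simp add: sum_negf)
qed

end

section \<open>Character sums\<close>

text \<open>Nontriviality of the canonical character is only assumed here. It is discharged in
  \<open>three_valued_periods\<close>, where a trivial character would make all periods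
  equal.\<close>

locale quadratic_extension_char = quadratic_extension +
  assumes nontrivial: "\<exists>x\<in>GF_sub Q. add_char Q (x :: 'a) \<noteq> 1"
begin

section \<open>Orthogonality relations and the quadratic Gauss sum\<close>

definition G :: complex where "G = (\<Sum>z\<in>F - {0}. \<eta> z * \<psi> z)"

text \<open>For nonzero t, shifting z by c/t multiplies the sum by \<psi>(c), which is not
  1.\<close>

lemma sum_psi: assumes t: "t \<in> F" shows "(\<Sum>z\<in>F. \<psi> (t * z)) = (if t = 0 then of_nat Q else 0)"
proof (cases "t = 0")
  case False
  obtain c where c: "c \<in> F" "\<psi> c \<noteq> 1" using nontrivial by blast
  have "(\<Sum>z\<in>F. \<psi> (t * z)) = (\<Sum>z\<in>F. \<psi> (t * (z + c / t)))"
    by (rule sum_F_shift[symmetric]) (simp add: c t F_divide)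
  also have "\<dots> = (\<Sum>z\<in>F. \<psi> c * \<psi> (t * z))"
  proof (rule sum.cong[OF refl])
    fix z assume z: "z \<in> F"
    have "t * (z + c / t) = c + t * z" using False by (simp add: field_simps)
    then show "\<psi> (t * (z + c / t)) = \<psi> c * \<psi> (t * z)" using c t z by (simp add: psi_add F_mult)
  qed
  also have "\<dots> = \<psi> c * (\<Sum>z\<in>F. \<psi> (t * z))"
    by (rule sum_distrib_left[symmetric])
  finally show ?thesis using c False by (simp only: mult_cancel_right1) simp
qed (simp add: card_F)

lemma sum_psi_units:
  assumes t: "t \<in> F" shows "(\<Sum>z\<in>F - {0}. \<psi> (t * z)) = (if t = 0 then of_nat Q else 0) - 1"
proof -
  have "(\<Sum>z\<in>F. \<psi> (t * z)) = \<psi> (t * 0) + (\<Sum>z\<in>F - {0}. \<psi> (t * z))"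
    by (rule sum.remove) auto
  then show ?thesis using sum_psi[OF t] by simp
qed

lemma sum_psi_tr: "(\<Sum>x\<in>UNIV. \<psi> (tr (y * x))) = (if y = 0 then of_nat (Q\<^sup>2) else 0)"
proof (cases "y = 0")
  case True
  then show ?thesis using card_UNIV Q_pos by (simp add: tr_def zero_power)
next
  case False
  obtain c where c: "c \<in> F" "\<psi> c \<noteq> 1" using nontrivial by blast
  \<comment> \<open>The shift argument needs an element of the large field with trace c; as tr(1) =
    2, c/2 is one.\<close>
  have "tr (c / 2) = c / 2 * tr 1"
    using tr_scale[of "c / 2" 1] c F_numeral by (simp add: F_divide)
  also have "tr 1 = 2" by (simp add: tr_def)
  finally have trc: "tr (c / 2) = c" by simp
  have "(\<Sum>x\<in>UNIV. \<psi> (tr (y * x))) = (\<Sum>x\<in>UNIV. \<psi> (tr (y * (x + c / 2 / y))))"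
    by (rule sum.reindex_bij_witness[of _ "\<lambda>x. x + c / 2 / y" "\<lambda>x. x - c / 2 / y"]) auto
  also have "\<dots> = (\<Sum>x\<in>UNIV. \<psi> c * \<psi> (tr (y * x)))"
  proof (rule sum.cong[OF refl])
    fix x
    have "y * (x + c / 2 / y) = c / 2 + y * x" using False by (simp add: field_simps)
    then have "tr (y * (x + c / 2 / y)) = c + tr (y * x)" using tr_add[of "c / 2" "y * x"] trc by simp
    then show "\<psi> (tr (y * (x + c / 2 / y))) = \<psi> c * \<psi> (tr (y * x))" using c by (simp add: psi_add)
  qed
  also have "\<dots> = \<psi> c * (\<Sum>x\<in>UNIV. \<psi> (tr (y * x)))"
    by (rule sum_distrib_left[symmetric])
  finally show ?thesis using c False by (simp only: mult_cancel_right1) simp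
qed

text \<open>Completing the square: \<open>u nm(x) + tr(y x) = u nm(x + y\<^sup>Q / u) - nm(y) / u\<close>.\<close>

lemma sum_psi_nm:
  assumes u: "u \<in> F" "u \<noteq> 0"
  shows "(\<Sum>x\<in>UNIV. \<psi> (u * nm x) * \<psi> (tr (y * x))) = - of_nat Q * \<psi> (- (nm y / u))"
proof -
  have nm_add: "nm (a + b) = nm a + nm b + tr (a * b ^ Q)" for a b
    by (simp add: nm_def tr_def power_Q_add power_mult_distrib power_Q_Q algebra_simps)
  have uQ: "u ^ Q = u" using u by (simp add: mem_F_iff)
  have complete: "\<psi> (u * nm x) * \<psi> (tr (y * x)) = \<psi> (- (nm y / u)) * \<psi> (u * nm (x + y ^ Q / u))" for x
  proof -
    have "nm (y ^ Q / u) = nm y / u\<^sup>2"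
      using u by (simp add: nm_def power_divide power_mult_distrib uQ power_Q_Q power2_eq_square mult.commute)
    moreover have "(y ^ Q / u) ^ Q = y / u" by (simp add: power_divide power_Q_Q uQ)
    ultimately have "nm (x + y ^ Q / u) = nm x + nm y / u\<^sup>2 + tr (x * (y / u))" by (simp add: nm_add)
    also have "tr (x * (y / u)) = tr (y * x) / u"
      using tr_scale[of "1 / u" "y * x"] u by (simp add: F_divide mult.commute)
    finally have "u * nm (x + y ^ Q / u) = u * nm x + nm y / u + tr (y * x)"
      using u by (simp add: field_simps power2_eq_square)
    then have "u * nm x + tr (y * x) = - (nm y / u) + u * nm (x + y ^ Q / u)" by simp
    moreover have "\<psi> (u * nm x + tr (y * x)) = \<psi> (u * nm x) * \<psi> (tr (y * x))"
      using u by (intro psi_add) (auto simp: F_mult)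
    moreover have "\<psi> (- (nm y / u) + u * nm (x + y ^ Q / u)) = \<psi> (- (nm y / u)) * \<psi> (u * nm (x + y ^ Q / u))"
      using u by (intro psi_add) (auto simp: F_mult F_divide F_minus)
    ultimately show ?thesis by (simp only:)
  qed
  have "(\<Sum>x\<in>UNIV. \<psi> (u * nm x) * \<psi> (tr (y * x)))
      = \<psi> (- (nm y / u)) * (\<Sum>x\<in>UNIV. \<psi> (u * nm (x + y ^ Q / u)))"
    unfolding sum_distrib_left by (rule sum.cong[OF refl], rule complete)
  also have "(\<Sum>x\<in>UNIV. \<psi> (u * nm (x + y ^ Q / u))) = (\<Sum>x\<in>UNIV. \<psi> (u * nm x))"
    by (rule sum.reindex_bij_witness[of _ "\<lambda>x. x - y ^ Q / u" "\<lambda>x. x + y ^ Q / u"]) auto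
  also have "\<dots> = \<psi> (u * nm 0) + (\<Sum>x\<in>UNIV - {0}. \<psi> (u * nm x))"
    by (rule sum.remove) auto
  also have "UNIV - {0} = - {0 :: 'a}" by auto
  also have "(\<Sum>x\<in>- {0}. \<psi> (u * nm x)) = of_nat (Q + 1) * (\<Sum>z\<in>F - {0}. \<psi> (u * z))"
    by (rule sum_nm)
  also have "\<psi> (u * nm 0) + \<dots> = - of_nat Q"
    using u by (simp add: sum_psi_units nm_def)
  finally show ?thesis by simp
qed

lemma gauss_sum_eq: "gauss_sum Q \<eta> = G"
  by (simp add: gauss_sum_def G_def)

lemma sum_eta_psi:
  assumes z: "z \<in> F - {0}"
  shows "(\<Sum>s\<in>F. \<eta> s * \<psi> (z * s)) = \<eta> z * G"
proof -
  have zz: "\<eta> z * \<eta> z = 1" using z eta_cases[of z] by auto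
  have "(\<Sum>s\<in>F. \<eta> s * \<psi> (z * s)) = (\<Sum>s\<in>F - {0}. \<eta> s * \<psi> (z * s))"
    by (subst sum.remove[of _ 0]) auto
  also have "\<dots> = (\<Sum>s\<in>F - {0}. \<eta> z * (\<eta> (z * s) * \<psi> (z * s)))"
  proof (rule sum.cong[OF refl])
    fix s assume "s \<in> F - {0}"
    then have "\<eta> z * (\<eta> (z * s) * \<psi> (z * s)) = (\<eta> z * \<eta> z) * (\<eta> s * \<psi> (z * s))"
      using z by (simp add: eta_mult)
    then show "\<eta> s * \<psi> (z * s) = \<eta> z * (\<eta> (z * s) * \<psi> (z * s))" by (simp add: zz)
  qed
  also have "\<dots> = \<eta> z * G"
    unfolding G_def sum_distrib_left[symmetric]
    by (simp only: sum_F_units_scale[OF z, of "\<lambda>s. \<eta> s * \<psi> s"])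
  finally show ?thesis .
qed

lemma sum_eta_psi_shift:
  assumes z: "z \<in> F - {0}"
  shows "(\<Sum>s\<in>F. \<eta> (s + 2) * \<psi> (z * s)) = \<eta> z * \<psi> (- 2 * z) * G"
proof -
  have "(\<Sum>s\<in>F. \<eta> (s + 2) * \<psi> (z * s)) = (\<Sum>s\<in>F. \<eta> (s + 2) * (\<psi> (- 2 * z) * \<psi> (z * (s + 2))))"
  proof (rule sum.cong[OF refl])
    fix s assume s: "s \<in> F"
    have "- 2 * z + z * (s + 2) = z * s" by (simp add: algebra_simps)
    then have "\<psi> (z * s) = \<psi> (- 2 * z) * \<psi> (z * (s + 2))"
      using psi_add[of "- 2 * z" "z * (s + 2)"] s z F_numeral by (simp add: F_mult F_add F_minus)
    then show "\<eta> (s + 2) * \<psi> (z * s) = \<eta> (s + 2) * (\<psi> (- 2 * z) * \<psi> (z * (s + 2)))" by simp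
  qed
  also have "\<dots> = (\<Sum>s\<in>F. \<eta> s * (\<psi> (- 2 * z) * \<psi> (z * s)))"
    by (rule sum_F_shift) (rule F_numeral)
  also have "\<dots> = \<psi> (- 2 * z) * (\<Sum>s\<in>F. \<eta> s * \<psi> (z * s))"
    by (simp add: sum_distrib_left algebra_simps)
  finally show ?thesis by (simp add: sum_eta_psi[OF z])
qed

text \<open>The classical evaluation as \<eta>(-1) Q. After one factor is absorbed by
  \<open>sum_eta_psi\<close>, the sum over z is -1 except at s = -1, and the constant parts cancel
  because \<eta> sums to 0.\<close>

lemma G_square: "G\<^sup>2 = - of_nat Q"
proof -
  have "G\<^sup>2 = (\<Sum>z\<in>F - {0}. \<eta> z * \<psi> z * G)"
    unfolding power2_eq_square by (subst G_def) (simp add: sum_distrib_right)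
  also have "\<dots> = (\<Sum>z\<in>F - {0}. \<Sum>s\<in>F. \<eta> s * (\<psi> z * \<psi> (z * s)))"
  proof (rule sum.cong[OF refl])
    fix z assume z: "z \<in> F - {0}"
    have "\<eta> z * \<psi> z * G = \<psi> z * (\<Sum>s\<in>F. \<eta> s * \<psi> (z * s))" using sum_eta_psi[OF z] by simp
    then show "\<eta> z * \<psi> z * G = (\<Sum>s\<in>F. \<eta> s * (\<psi> z * \<psi> (z * s)))"
      by (simp add: sum_distrib_left algebra_simps)
  qed
  also have "\<dots> = (\<Sum>s\<in>F. \<Sum>z\<in>F - {0}. \<eta> s * (\<psi> z * \<psi> (z * s)))" by (rule sum.swap)
  also have "\<dots> = (\<Sum>s\<in>F. \<eta> s * ((if s = - 1 then of_nat Q else 0) - 1))"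
  proof (rule sum.cong[OF refl])
    fix s assume s: "s \<in> F"
    have "(\<Sum>z\<in>F - {0}. \<psi> z * \<psi> (z * s)) = (\<Sum>z\<in>F - {0}. \<psi> ((1 + s) * z))"
    proof (rule sum.cong[OF refl])
      fix z assume "z \<in> F - {0}"
      then show "\<psi> z * \<psi> (z * s) = \<psi> ((1 + s) * z)"
        using s psi_add[of z "z * s"] by (simp add: F_mult algebra_simps)
    qed
    also have "\<dots> = (if s = - 1 then of_nat Q else 0) - 1"
      using s by (simp add: sum_psi_units F_add add_eq_0_iff)
    finally show "(\<Sum>z\<in>F - {0}. \<eta> s * (\<psi> z * \<psi> (z * s))) = \<eta> s * ((if s = - 1 then of_nat Q else 0) - 1)"
      by (simp only: sum_distrib_left[symmetric])
  qed
  also have "\<dots> = (\<Sum>s\<in>F. (if s = - 1 then of_nat Q * \<eta> s else 0) - \<eta> s)"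
    by (rule sum.cong) (auto simp: right_diff_distrib)
  also have "\<dots> = (\<Sum>s\<in>F. (if s = - 1 then of_nat Q * \<eta> s else 0)) - (\<Sum>s\<in>F. \<eta> s)"
    by (rule sum_subtractf)
  also have "(\<Sum>s\<in>F. \<eta> s) = 0"
    using sum_eta by (subst sum.remove[of _ 0]) auto
  finally show ?thesis by (simp add: F_minus eta_minus_1)
qed

section \<open>Sums twisted by a function of the logarithm that changes sign under a shift by
  2\<close>

context
  fixes \<chi> :: "int \<Rightarrow> complex"
  assumes anti: "\<And>k. \<chi> (k + 2) = - \<chi> k"
begin

lemma chi_add_even: "\<chi> (k + 2 * j) = (if even j then \<chi> k else - \<chi> k)"
proof (induction j rule: int_induct[of _ 0])
  case (step1 i)
  then show ?case using anti[of "k + 2 * i"] by (simp add: algebra_simps)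
next
  case (step2 i)
  then show ?case using anti[of "k + 2 * (i - 1)"] by (auto simp: algebra_simps split: if_splits)
qed simp

lemma chi_cong: assumes "[a = b] (mod 4)" shows "\<chi> a = \<chi> b"
proof -
  obtain j where "a - b = 4 * j" using assms by (auto simp: cong_iff_dvd_diff)
  then have "a = b + 2 * (2 * j)" by simp
  then show ?thesis using chi_add_even[of b "2 * j"] by simp
qed

text \<open>\<open>x\<close> and \<open>x\<^sup>Q\<close> have the same norm and trace, so only this symmetrisation of \<open>\<chi> \<circ> ind\<close> matters in
  \<open>twisted_sum\<close>; the factor \<open>1 + \<eta> (nm x)\<close> kills the nonsquares and counts the factorisations
  \<open>x = z u\<close> with \<open>z \<in> F\<close>, \<open>u \<in> U\<close> of a square.\<close>

lemma symmetrised_chi: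
  assumes "x \<noteq> 0" "y \<noteq> 0"
  shows "\<chi> (ind (x / y)) + \<chi> (ind (x ^ Q / y)) = (1 + \<eta> (nm x)) * \<epsilon> x * \<chi> (- ind y)"
proof -
  have xQ: "[ind (x ^ Q) = - ind x] (mod 4)"
  proof -
    have "[int Q = -1] (mod 4)"
      using four_dvd by (metis cong_iff_dvd_diff diff_minus_eq_add int_dvd_int_iff of_nat_1 of_nat_add of_nat_numeral)
    then have "[int Q * ind x = - 1 * ind x] (mod 4)" by (rule cong_scalar_right)
    then show ?thesis using ind_power_4[OF assms(1), of Q] by (auto intro: cong_trans)
  qed
  have 1: "\<chi> (ind (x / y)) = \<chi> (ind x - ind y)"
    by (rule chi_cong) (rule ind_divide_4[OF assms])
  have 2: "\<chi> (ind (x ^ Q / y)) = \<chi> (- ind x - ind y)"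
  proof (rule chi_cong)
    have "[ind (x ^ Q / y) = ind (x ^ Q) - ind y] (mod 4)" using assms by (intro ind_divide_4) auto
    also have "[ind (x ^ Q) - ind y = - ind x - ind y] (mod 4)" by (rule cong_diff[OF xQ cong_refl])
    finally show "[ind (x ^ Q / y) = - ind x - ind y] (mod 4)" .
  qed
  have "[indF (nm x) = ind x] (mod 2)"
    using indF_nm[OF assms(1)] even_Q_minus_1 by (rule cong_dvd_modulus)
  then have par: "even (indF (nm x)) \<longleftrightarrow> even (ind x)" by (simp add: cong_def even_iff_mod_2_eq_zero)
  have eta: "\<eta> (nm x) = (if even (ind x) then 1 else - 1)" using eta_eq[of "nm x"] assms par by simp
  show ?thesis
  proof (cases "even (ind x)")
    case True
    then obtain k where k: "ind x = 2 * k" by blast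
    have "ind x - ind y = - ind y + 2 * k" "- ind x - ind y = - ind y + 2 * (- k)" by (simp_all add: k)
    then have "\<chi> (ind x - ind y) = (if even k then \<chi> (- ind y) else - \<chi> (- ind y))"
      "\<chi> (- ind x - ind y) = (if even k then \<chi> (- ind y) else - \<chi> (- ind y))"
      by (simp_all only: chi_add_even even_minus)
    moreover have "4 dvd ind x \<longleftrightarrow> even k" unfolding k by presburger
    ultimately show ?thesis using True by (simp add: 1 2 eta \<epsilon>_def)
  next
    case False
    have "ind x - ind y = (- ind x - ind y) + 2 * ind x" by simp
    then have "\<chi> (ind x - ind y) = - \<chi> (- ind x - ind y)" using False chi_add_even by metis
    then show ?thesis using False by (simp add: 1 2 eta)
  qed
qed

text \<open>Multiplication by \<open>\<gamma> powi (Q - 1)\<close> preserves the norm and adds Q -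
  1, which is 2 modulo 4, to the logarithm. It thus negates every summand.\<close>

lemma twisted_sum_0: "(\<Sum>x\<in>- {0}. \<chi> (ind x) * g (nm x)) = 0"
proof -
  define u where "u = \<gamma> powi (int (Q - 1))"
  have u0: "u \<noteq> 0" by (simp add: u_def)
  have "nm u = \<omega> powi 0" unfolding u_def nm_powi omega_powi_eq_iff cong_0_iff by (rule dvd_refl)
  then have nmu: "nm u = 1" by simp
  have "[ind u = int (Q - 1)] (mod int (Q\<^sup>2 - 1))"
    using ind_cong[OF u0, of "int (Q - 1)"] u_def by blast
  then have "[ind u = int (Q - 1)] (mod 4)" using four_dvd_units cong_dvd_modulus by blast
  moreover have "[int (Q - 1) = 2] (mod 4)"
    using Q_mod_4 by (simp add: of_nat_diff cong_def) presburger
  ultimately have indu: "[ind u = 2] (mod 4)" by (rule cong_trans)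
  have "(\<Sum>x\<in>- {0}. \<chi> (ind x) * g (nm x)) = (\<Sum>x\<in>- {0}. \<chi> (ind (u * x)) * g (nm (u * x)))"
    by (rule sum_units_scale[OF u0, symmetric])
  also have "\<dots> = (\<Sum>x\<in>- {0}. - (\<chi> (ind x) * g (nm x)))"
  proof (rule sum.cong[OF refl])
    fix x :: 'a assume "x \<in> - {0}"
    then have "[ind (u * x) = ind u + ind x] (mod 4)" using u0 by (intro ind_mult_4) auto
    also have "[ind u + ind x = 2 + ind x] (mod 4)" by (rule cong_add[OF indu cong_refl])
    finally have "\<chi> (ind (u * x)) = - \<chi> (ind x)" using chi_cong anti[of "ind x"] by (metis add.commute)
    then show "\<chi> (ind (u * x)) * g (nm (u * x)) = - (\<chi> (ind x) * g (nm x))"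
      by (simp add: nm_mult nmu)
  qed
  finally show ?thesis by (simp add: sum_negf)
qed

text \<open>After replacing x by x/y and averaging over conjugation, the factorisation x = z u
  separates the variables: g sees only z^2, the sign only u, and the character only z tr(u).
  \<open>sum_U_epsilon\<close> then turns the sum over u into shifted Gauss sums over
  \<open>F\<close>.\<close>

lemma twisted_sum:
  assumes y: "y \<noteq> 0"
  shows "(\<Sum>x\<in>- {0}. \<chi> (ind x) * g (nm x) * \<psi> (tr (y * x)))
    = \<chi> (- ind y) * G * (\<Sum>z\<in>F - {0}. \<eta> z * g (z\<^sup>2 / nm y) * \<psi> (- 2 * z))"
    (is "?T = _")
proof -
  define K where "K s = (\<Sum>z\<in>F - {0}. g (z\<^sup>2 / nm y) * \<psi> (z * s))" for s
  define R where "R x = g (nm x / nm y) * \<psi> (tr x)" for x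
  have "(\<Sum>x\<in>- {0}. \<chi> (ind x) * g (nm x) * \<psi> (tr (y * x)))
      = (\<Sum>x\<in>- {0}. \<chi> (ind (x / y)) * g (nm (x / y)) * \<psi> (tr (y * (x / y))))"
    using sum_units_scale[of "1 / y" "\<lambda>x. \<chi> (ind x) * g (nm x) * \<psi> (tr (y * x))"] y by simp
  then have T1: "?T = (\<Sum>x\<in>- {0}. \<chi> (ind (x / y)) * R x)"
    using y by (simp add: nm_divide R_def mult.assoc)
  \<comment> \<open>Conjugation permutes the nonzero elements and leaves R unchanged, so only the
    sign factor is affected.\<close>
  have "(\<Sum>x\<in>- {0}. \<chi> (ind (x / y)) * R x) = (\<Sum>x\<in>- {0}. \<chi> (ind (x ^ Q / y)) * R (x ^ Q))"
    by (rule sum.reindex_bij_witness[of _ "\<lambda>x. x ^ Q" "\<lambda>x. x ^ Q"]) (auto simp: power_Q_Q)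
  moreover have "R (x ^ Q) = R x" for x
    by (simp add: R_def nm_def tr_def power_mult_distrib power_Q_Q mult.commute add.commute)
  ultimately have T2: "?T = (\<Sum>x\<in>- {0}. \<chi> (ind (x ^ Q / y)) * R x)" using T1 by simp
  have "2 * ?T = (\<Sum>x\<in>- {0}. (\<chi> (ind (x / y)) + \<chi> (ind (x ^ Q / y))) * R x)"
    using T1 T2 by (simp add: distrib_right sum.distrib)
  also have "\<dots> = \<chi> (- ind y) * (\<Sum>x\<in>- {0}. (1 + \<eta> (nm x)) * (\<epsilon> x * R x))"
    unfolding sum_distrib_left by (rule sum.cong[OF refl]) (use y in \<open>simp add: symmetrised_chi\<close>)
  also have "(\<Sum>x\<in>- {0}. (1 + \<eta> (nm x)) * (\<epsilon> x * R x)) = (\<Sum>z\<in>F - {0}. \<Sum>u\<in>U. \<epsilon> (z * u) * R (z * u))"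
    by (rule sum_products[symmetric])
  also have "\<dots> = (\<Sum>z\<in>F - {0}. \<Sum>u\<in>U. \<epsilon> u * (g (z\<^sup>2 / nm y) * \<psi> (z * tr u)))"
  proof (intro sum.cong refl)
    fix z u assume z: "z \<in> F - {0}" and u: "u \<in> U"
    have u0: "u \<noteq> 0" using u unfolding U_def by (metis mem_Collect_eq nm_eq_0_iff zero_neq_one)
    have "[ind (z * u) = ind z + ind u] (mod 4)" using z u0 by (intro ind_mult_4) auto
    then have "4 dvd ind (z * u) \<longleftrightarrow> 4 dvd ind z + ind u" by (rule cong_dvd_iff[OF _ , of _ _ 4, simplified])
    also have "\<dots> \<longleftrightarrow> 4 dvd ind u" using ind_F[of z] z by (simp add: dvd_add_right_iff)
    finally have "\<epsilon> (z * u) = \<epsilon> u" by (simp add: \<epsilon>_def)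
    moreover have "nm (z * u) = z\<^sup>2"
      using z u by (simp add: nm_mult U_def) (simp add: nm_def mem_F_iff power2_eq_square)
    ultimately show "\<epsilon> (z * u) * R (z * u) = \<epsilon> u * (g (z\<^sup>2 / nm y) * \<psi> (z * tr u))"
      using z by (simp add: R_def tr_scale)
  qed
  also have "\<dots> = (\<Sum>u\<in>U. \<epsilon> u * K (tr u))"
    unfolding K_def sum_distrib_left by (rule sum.swap)
  also have "\<dots> = 2 * (\<Sum>s\<in>F. \<eta> (s + 2) * K s)"
  proof (rule sum_U_epsilon)
    fix s
    \<comment> \<open>K is even because g depends on z only through z^2, so z may be replaced by
      -z.\<close>
    have "K (- s) = (\<Sum>z\<in>F - {0}. g ((- z)\<^sup>2 / nm y) * \<psi> ((- z) * s))" by (simp add: K_def)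
    also have "\<dots> = K s"
      unfolding K_def
      using sum_F_units_scale[of "- 1" "\<lambda>z. g (z\<^sup>2 / nm y) * \<psi> (z * s)"] by (simp add: F_minus)
    finally show "K (- s) = K s" .
  qed
  also have "(\<Sum>s\<in>F. \<eta> (s + 2) * K s)
      = (\<Sum>z\<in>F - {0}. g (z\<^sup>2 / nm y) * (\<Sum>s\<in>F. \<eta> (s + 2) * \<psi> (z * s)))"
    unfolding K_def sum_distrib_left by (subst sum.swap) (simp add: ac_simps)
  also have "\<dots> = (\<Sum>z\<in>F - {0}. G * (\<eta> z * g (z\<^sup>2 / nm y) * \<psi> (- 2 * z)))"
    by (rule sum.cong[OF refl], subst sum_eta_psi_shift) (assumption, simp add: ac_simps)
  also have "\<dots> = G * (\<Sum>z\<in>F - {0}. \<eta> z * g (z\<^sup>2 / nm y) * \<psi> (- 2 * z))"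
    by (simp only: sum_distrib_left)
  finally show ?thesis by (simp add: ac_simps)
qed

end


section \<open>Strongly regular graphs from two character values\<close>

text \<open>Fourier inversion: multiplying by the character value at -ya and summing over y isolates
  the coefficient at a.\<close>

lemma fourier_injective:
  fixes c :: "'a \<Rightarrow> complex"
  assumes "\<And>y. (\<Sum>x\<in>UNIV. c x * \<psi> (tr (y * x))) = 0"
  shows "c a = 0"
proof -
  have split: "\<psi> (tr (y * (x - a))) = \<psi> (tr (y * (- a))) * \<psi> (tr (y * x))" for x y
    using psi_add[of "tr (y * (- a))" "tr (y * x)"] tr_add[of "y * (- a)" "y * x"]
    by (simp add: algebra_simps)
  have "0 = (\<Sum>y\<in>UNIV. \<psi> (tr (y * (- a))) * (\<Sum>x\<in>UNIV. c x * \<psi> (tr (y * x))))"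
    by (simp add: assms)
  also have "\<dots> = (\<Sum>y\<in>UNIV. \<Sum>x\<in>UNIV. c x * \<psi> (tr ((x - a) * y)))"
    unfolding sum_distrib_left by (intro sum.cong refl) (simp only: split ac_simps mult.commute[of "_ - _"])
  also have "\<dots> = (\<Sum>x\<in>UNIV. \<Sum>y\<in>UNIV. c x * \<psi> (tr ((x - a) * y)))"
    by (rule sum.swap)
  also have "\<dots> = (\<Sum>x\<in>UNIV. if x = a then c x * of_nat (Q\<^sup>2) else 0)"
    unfolding sum_distrib_left[symmetric] by (rule sum.cong) (auto simp: sum_psi_tr)
  also have "\<dots> = c a * of_nat (Q\<^sup>2)" by simp
  finally show ?thesis using Q_pos by simp
qed

text \<open>The number n(d) of ways to write d as a difference of elements of D has Fourier
  transform \<theta>^2. The numbers m(d) prescribed by the parameters have the same transform,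
  because the two admissible character values are the roots of one quadratic equation; hence n =
  m.\<close>

lemma strongly_regular_Cay:
  fixes D :: "'a set" and r :: nat
  assumes D0: "0 \<notin> D" and sym: "\<And>x. x \<in> D \<Longrightarrow> - x \<in> D"
    and card_D: "card D = r * (Q + 1)"
    and char_sums: "\<And>y. y \<noteq> 0 \<Longrightarrow> (\<Sum>x\<in>D. \<psi> (tr (y * x))) \<in> {of_nat r, of_nat r - of_nat Q}"
  shows "strongly_regular (Cay D) ((int Q)\<^sup>2) (int r * (int Q + 1))
           (- int Q + (int r)\<^sup>2 + 3 * int r) ((int r)\<^sup>2 + int r)"
proof -
  define \<theta> where "\<theta> y = (\<Sum>x\<in>D. \<psi> (tr (y * x)))" for y
  define n where "n d = card {w \<in> D. w - d \<in> D}" for d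
  \<comment> \<open>The three coefficients are \<lambda> - \<mu>, k - \<mu> and \<mu> for the
    claimed parameters.\<close>
  define m where "m d = (2 * int r - int Q) * (if d \<in> D then 1 else 0)
      + int r * (int Q - int r) * (if d = 0 then 1 else 0) + ((int r)\<^sup>2 + int r)" for d
  have theta_minus: "(\<Sum>v\<in>D. \<psi> (tr (y * (- v)))) = \<theta> y" for y
    unfolding \<theta>_def by (rule sum.reindex_bij_witness[of _ uminus uminus]) (auto simp: sym)
  have hat_n: "(\<Sum>d\<in>UNIV. of_nat (n d) * \<psi> (tr (y * d))) = (\<theta> y)\<^sup>2" for y
  proof -
    have "(\<Sum>d\<in>UNIV. of_nat (n d) * \<psi> (tr (y * d)))
        = (\<Sum>d\<in>UNIV. \<Sum>w\<in>D. if w - d \<in> D then \<psi> (tr (y * d)) else 0)"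
      by (simp add: n_def flip: sum.inter_filter)
    also have "\<dots> = (\<Sum>w\<in>D. \<Sum>d\<in>UNIV. if w - d \<in> D then \<psi> (tr (y * d)) else 0)"
      by (rule sum.swap)
    also have "\<dots> = (\<Sum>w\<in>D. \<Sum>v\<in>D. \<psi> (tr (y * w)) * \<psi> (tr (y * (- v))))"
    proof (rule sum.cong[OF refl])
      fix w
      have "(\<Sum>d\<in>UNIV. if w - d \<in> D then \<psi> (tr (y * d)) else 0)
          = (\<Sum>d\<in>{d \<in> UNIV. w - d \<in> D}. \<psi> (tr (y * d)))"
        by (rule sum.inter_filter[symmetric]) simp
      also have "\<dots> = (\<Sum>v\<in>D. \<psi> (tr (y * (w - v))))"
        by (rule sum.reindex_bij_witness[of _ "\<lambda>v. w - v" "\<lambda>d. w - d"]) auto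
      also have "\<dots> = (\<Sum>v\<in>D. \<psi> (tr (y * w)) * \<psi> (tr (y * (- v))))"
      proof (rule sum.cong[OF refl])
        fix v
        show "\<psi> (tr (y * (w - v))) = \<psi> (tr (y * w)) * \<psi> (tr (y * (- v)))"
          using psi_add[of "tr (y * w)" "tr (y * (- v))"] tr_add[of "y * w" "y * (- v)"]
          by (simp add: algebra_simps)
      qed
      finally show "(\<Sum>d\<in>UNIV. if w - d \<in> D then \<psi> (tr (y * d)) else 0)
          = (\<Sum>v\<in>D. \<psi> (tr (y * w)) * \<psi> (tr (y * (- v))))" .
    qed
    also have "\<dots> = \<theta> y * \<theta> y"
      by (simp only: sum_distrib_left[symmetric] sum_distrib_right[symmetric] theta_minus)
         (simp only: \<theta>_def)
    finally show ?thesis by (simp add: power2_eq_square)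
  qed
  have hat_m: "(\<Sum>d\<in>UNIV. of_int (m d) * \<psi> (tr (y * d)))
      = (2 * of_nat r - of_nat Q) * \<theta> y + of_nat r * (of_nat Q - of_nat r)
        + (of_nat r ^ 2 + of_nat r) * (if y = 0 then of_nat (Q\<^sup>2) else 0)" for y
  proof -
    have "of_int (m d) * \<psi> (tr (y * d)) =
        (2 * of_nat r - of_nat Q) * (if d \<in> D then \<psi> (tr (y * d)) else 0)
        + (if d = 0 then of_nat r * (of_nat Q - of_nat r) * \<psi> (tr (y * d)) else 0)
        + (of_nat r ^ 2 + of_nat r) * \<psi> (tr (y * d))" for d
      by (simp add: m_def algebra_simps)
    then have "(\<Sum>d\<in>UNIV. of_int (m d) * \<psi> (tr (y * d))) =
        (2 * of_nat r - of_nat Q) * (\<Sum>d\<in>UNIV. if d \<in> D then \<psi> (tr (y * d)) else 0)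
        + (\<Sum>d\<in>UNIV. if d = 0 then of_nat r * (of_nat Q - of_nat r) * \<psi> (tr (y * d)) else 0)
        + (of_nat r ^ 2 + of_nat r) * (\<Sum>d\<in>UNIV. \<psi> (tr (y * d)))"
      by (simp only: sum.distrib sum_distrib_left[symmetric])
    moreover have "(\<Sum>d\<in>UNIV. if d \<in> D then \<psi> (tr (y * d)) else 0) = \<theta> y"
      unfolding \<theta>_def by (simp flip: sum.inter_filter)
    moreover have "tr 0 = 0" using Q_pos by (simp add: tr_def zero_power)
    ultimately show ?thesis by (simp add: sum_psi_tr)
  qed
  have "of_nat (n d) - of_int (m d) = (0 :: complex)" for d
  proof (rule fourier_injective[where c = "\<lambda>d. of_nat (n d) - of_int (m d)"])
    fix y :: 'a
    \<comment> \<open>For nonzero y this says (\<theta> - r)(\<theta> - r + Q) = 0. For y = 0 it is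
      a numerical identity for \<theta> = r(Q + 1), the size of D.\<close>
    have "(\<theta> y)\<^sup>2 = (2 * of_nat r - of_nat Q) * \<theta> y + of_nat r * (of_nat Q - of_nat r)
        + (of_nat r ^ 2 + of_nat r) * (if y = 0 then of_nat (Q\<^sup>2) else 0)"
    proof (cases "y = 0")
      case True
      have "tr 0 = 0" using Q_pos by (simp add: tr_def zero_power)
      then have "\<theta> y = of_nat r * (of_nat Q + 1)" using True card_D by (simp add: \<theta>_def algebra_simps)
      then show ?thesis using True by (simp add: power2_eq_square algebra_simps)
    next
      case False
      then consider "\<theta> y = of_nat r" | "\<theta> y = of_nat r - of_nat Q"
        using char_sums[of y] by (auto simp: \<theta>_def)
      then show ?thesis
        by cases (simp_all only: False if_False, simp_all add: power2_eq_square algebra_simps)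
    qed
    then show "(\<Sum>d\<in>UNIV. (of_nat (n d) - of_int (m d)) * \<psi> (tr (y * d))) = 0"
      by (simp only: left_diff_distrib sum_subtractf hat_n hat_m) simp
  qed
  then have "(of_int (int (n d)) :: complex) = of_int (m d)" for d by simp
  then have nm: "int (n d) = m d" for d by (simp only: of_int_eq_iff)
  have common: "card {z. x - z \<in> D \<and> y - z \<in> D} = n (x - y)" for x y
  proof -
    have "bij_betw (\<lambda>z. x - z) {z. x - z \<in> D \<and> y - z \<in> D} {w \<in> D. w - (x - y) \<in> D}"
      by (rule bij_betw_byWitness[where f' = "\<lambda>w. x - w"]) (auto simp: algebra_simps)
    then show ?thesis unfolding n_def by (rule bij_betw_same_card)
  qed
  have degree: "card {y. x - y \<in> D} = r * (Q + 1)" for x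
  proof -
    have "bij_betw (\<lambda>y. x - y) {y. x - y \<in> D} D"
      by (rule bij_betw_byWitness[where f' = "\<lambda>w. x - w"]) auto
    then show ?thesis using card_D bij_betw_same_card by metis
  qed
  have "pair_graph (Cay D)"
  proof
    show "symmetric (with_proj (Cay D))"
      unfolding symmetric_conv
    proof
      fix e assume "e \<in> arcs (with_proj (Cay D))"
      then have "(snd e, fst e) \<in> parcs (Cay D)"
        using sym[of "fst e - snd e"] by (auto simp: Cay_def)
      then show "\<exists>e'\<in>arcs (with_proj (Cay D)). tail (with_proj (Cay D)) e = head (with_proj (Cay D)) e' \<and>
          head (with_proj (Cay D)) e = tail (with_proj (Cay D)) e'"
        by (intro bexI[of _ "(snd e, fst e)"]) simp_all
    qed
  qed (auto simp: Cay_def D0)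
  then show ?thesis
    unfolding strongly_regular_def
    by (auto simp: Cay_def card_UNIV degree common nm m_def algebra_simps)
qed

end

section \<open>Cyclotomic classes\<close>

lemma mem_inv_scale_iff:
  assumes "coprime a (int N)" and N: "N > 0" and "I \<subseteq> {0..<int N}"
  shows "j \<in> inv_scale N a I \<longleftrightarrow> j \<in> {0..<int N} \<and> (a * j) mod int N \<in> I"
proof
  let ?b = "modular_inverse (int N) a"
  have b: "[a * ?b = 1] (mod int N)" using assms(1) N by (intro cong_modular_inverse1) auto
  {
    assume "j \<in> inv_scale N a I"
    then obtain i where i: "i \<in> I" "j = (?b * i) mod int N" by (auto simp: inv_scale_def)
    have "[a * j = a * (?b * i)] (mod int N)" unfolding i by (simp add: cong_def mod_mult_right_eq)
    also have "[a * (?b * i) = 1 * i] (mod int N)"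
      using cong_scalar_right[OF b, of i] by (simp add: mult.assoc)
    finally have "(a * j) mod int N = i mod int N" by (simp add: cong_def)
    then show "j \<in> {0..<int N} \<and> (a * j) mod int N \<in> I" using i assms by auto
  }
  {
    assume j: "j \<in> {0..<int N} \<and> (a * j) mod int N \<in> I"
    have "[?b * ((a * j) mod int N) = ?b * (a * j)] (mod int N)" by (simp add: cong_def mod_mult_right_eq)
    also have "[?b * (a * j) = 1 * j] (mod int N)"
      using cong_scalar_right[OF b, of j] by (simp add: ac_simps)
    finally have "(?b * ((a * j) mod int N)) mod int N = j" using j by (simp add: cong_def)
    then show "j \<in> inv_scale N a I" using j unfolding inv_scale_def by (metis imageI)
  }
qed

text \<open>By the Chinese remainder theorem, N i + 4 j modulo 4N is determined by N i modulo 4 and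
  by 4 j modulo N. The factor 4 undoes the scaling in \<open>inv_scale\<close>.\<close>

lemma Y_index_cong:
  fixes e :: int
  assumes N: "odd N" and I: "I \<subseteq> {0..<int N}"
  shows "(\<exists>i\<in>A. \<exists>j\<in>inv_scale N 4 I. [e = int N * i + 4 * j] (mod 4 * int N))
    \<longleftrightarrow> e mod int N \<in> I \<and> (\<exists>i\<in>A. [e = int N * i] (mod 4))"
proof -
  have N0: "N > 0" using N by (cases N) auto
  have cop2: "coprime 2 (int N)" using N by simp
  then have cop: "coprime 4 (int N)" using coprime_power_left_iff[of 2 2 "int N"] by simp
  note mem = mem_inv_scale_iff[OF cop N0 I]
  have eq: "[e = int N * i + 4 * j] (mod 4 * int N) \<longleftrightarrow> [e = int N * i] (mod 4) \<and> [e = 4 * j] (mod int N)" for i j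
  proof -
    have "[e = int N * i + 4 * j] (mod 4 * int N)
        \<longleftrightarrow> [e = int N * i + 4 * j] (mod 4) \<and> [e = int N * i + 4 * j] (mod int N)"
      using cop by (meson coprime_cong_mult cong_dvd_modulus dvd_triv_left dvd_triv_right)
    then show ?thesis by (simp add: cong_def)
  qed
  have "(\<exists>j\<in>inv_scale N 4 I. [e = 4 * j] (mod int N)) \<longleftrightarrow> e mod int N \<in> I"
  proof
    assume "\<exists>j\<in>inv_scale N 4 I. [e = 4 * j] (mod int N)"
    then obtain j where "j \<in> inv_scale N 4 I" and "e mod int N = (4 * j) mod int N"
      unfolding cong_def by blast
    then show "e mod int N \<in> I" using mem[of j] by simp
  next
    assume e: "e mod int N \<in> I"
    obtain y where "[4 * y = 1] (mod int N)" using cong_solve_coprime_int[OF cop] by blast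
    then have x: "[4 * (y * e) = e] (mod int N)" using cong_scalar_right[of "4 * y" 1 "int N" e] by (simp add: mult.assoc)
    define j where "j = (y * e) mod int N"
    have j: "(4 * j) mod int N = e mod int N" using x by (simp add: j_def cong_def mod_mult_right_eq)
    then have "j \<in> inv_scale N 4 I" using e N0 by (simp add: mem) (simp add: j_def)
    then show "\<exists>j\<in>inv_scale N 4 I. [e = 4 * j] (mod int N)" 
      by (intro bexI[of _ j]) (simp_all add: j cong_def)
  qed
  then show ?thesis unfolding eq by blast
qed

text \<open>Since N is odd, the parity of e tells whether it comes from 2j or from 2j + N. In both
  cases 2e is 4j modulo N, which undoes the scaling.\<close>

lemma X_index_cong:
  fixes e :: int
  assumes N: "odd N" and I: "S1 \<subseteq> {0..<int N}" "S2 \<subseteq> {0..<int N}"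
  shows "(\<exists>l\<in>X_index N S1 S2. [e = l] (mod int (2 * N)))
    \<longleftrightarrow> even e \<and> (2 * e) mod int N \<in> S1 \<or> odd e \<and> (2 * e) mod int N \<in> S2"
proof -
  have N0: "N > 0" using N by (cases N) auto
  have cop2: "coprime 2 (int N)" using N by simp
  then have cop: "coprime 4 (int N)" using coprime_power_left_iff[of 2 2 "int N"] by simp
  have half: "(\<exists>j\<in>inv_scale N 4 S. [e' = 2 * j] (mod 2 * int N)) \<longleftrightarrow> even e' \<and> (2 * e') mod int N \<in> S"
    if S: "S \<subseteq> {0..<int N}" for S e'
  proof
    assume "\<exists>j\<in>inv_scale N 4 S. [e' = 2 * j] (mod 2 * int N)"
    then obtain j where "j \<in> inv_scale N 4 S" "[e' = 2 * j] (mod 2 * int N)" by blast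
    then have j: "(4 * j) mod int N \<in> S" "[e' = 2 * j] (mod 2 * int N)"
      unfolding mem_inv_scale_iff[OF cop N0 S] by blast+
    have "[e' = 2 * j] (mod 2)" using j(2) by (rule cong_dvd_modulus) simp
    have "[2 * e' = 2 * (2 * j)] (mod int N)"
      using j(2) by (intro cong_scalar_left) (rule cong_dvd_modulus, auto)
    then have "(2 * e') mod int N = (4 * j) mod int N" by (simp add: cong_def)
    moreover have "even e'" using \<open>[e' = 2 * j] (mod 2)\<close> by (simp add: cong_def even_iff_mod_2_eq_zero)
    ultimately show "even e' \<and> (2 * e') mod int N \<in> S" using j(1) by simp
  next
    assume e': "even e' \<and> (2 * e') mod int N \<in> S"
    then obtain f where f: "e' = 2 * f" by blast
    have "(4 * (f mod int N)) mod int N = (2 * e') mod int N" by (simp add: f mod_mult_right_eq)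
    then have "f mod int N \<in> inv_scale N 4 S"
      using e' N0 by (simp add: mem_inv_scale_iff[OF cop N0 S])
    moreover have "[e' = 2 * (f mod int N)] (mod 2 * int N)"
      by (simp only: f cong_def mult_mod_right mod_mod_trivial)
    ultimately show "\<exists>j\<in>inv_scale N 4 S. [e' = 2 * j] (mod 2 * int N)" by blast
  qed
  have "(\<exists>l\<in>X_index N S1 S2. [e = l] (mod int (2 * N))) \<longleftrightarrow>
      (\<exists>j\<in>inv_scale N 4 S1. [e = 2 * j] (mod 2 * int N)) \<or>
      (\<exists>j\<in>inv_scale N 4 S2. [e = 2 * j + int N] (mod 2 * int N))"
    unfolding X_index_def bex_Un by (simp add: cong_def)
  \<comment> \<open>Subtracting the odd number N reduces the second part to the even case without
    changing 2e modulo N.\<close>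
  also have "(\<exists>j\<in>inv_scale N 4 S2. [e = 2 * j + int N] (mod 2 * int N)) \<longleftrightarrow>
      (\<exists>j\<in>inv_scale N 4 S2. [e - int N = 2 * j] (mod 2 * int N))"
    by (simp add: cong_iff_dvd_diff algebra_simps)
  finally show ?thesis
    unfolding half[OF I(1)] half[OF I(2)] using N
    by (simp add: right_diff_distrib mod_diff_eq[symmetric, of "2 * e"])
qed

context quadratic_extension
begin

lemma mem_cyclotomic_class:
  assumes "int K dvd int (Q\<^sup>2 - 1)"
  shows "x \<in> cyclotomic_class \<gamma> K i \<longleftrightarrow> x \<noteq> 0 \<and> [ind x = i] (mod int K)"
proof -
  have eq: "cyclotomic_class \<gamma> K i = range (\<lambda>j. \<gamma> powi (i + int K * j))"
    unfolding cyclotomic_class_def power_int_power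
    by (intro image_cong refl) (simp only: power_int_add gamma_nonzero simp_thms)
  show ?thesis
  proof (cases "x = 0")
    case False
    have "x \<in> cyclotomic_class \<gamma> K i \<longleftrightarrow> (\<exists>j. [ind x = i + int K * j] (mod int (Q\<^sup>2 - 1)))"
      unfolding eq using ind_cong[OF False] by auto
    also have "\<dots> \<longleftrightarrow> [ind x = i] (mod int K)"
    proof
      assume "\<exists>j. [ind x = i + int K * j] (mod int (Q\<^sup>2 - 1))"
      then obtain j where "[ind x = i + int K * j] (mod int K)" using assms cong_dvd_modulus by blast
      then show "[ind x = i] (mod int K)" by (simp add: cong_def)
    next
      assume "[ind x = i] (mod int K)"
      then obtain j where "ind x - i = int K * j" by (auto simp: cong_iff_dvd_diff elim: dvdE)
      then have "ind x = i + int K * j" by simp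
      then show "\<exists>j. [ind x = i + int K * j] (mod int (Q\<^sup>2 - 1))" by (metis cong_refl)
    qed
    finally show ?thesis using False by simp
  qed (auto simp: eq)
qed

lemma mem_cyclotomic_class_omega:
  assumes "int K dvd int (Q - 1)"
  shows "x \<in> cyclotomic_class \<omega> K i \<longleftrightarrow> x \<in> F - {0} \<and> [indF x = i] (mod int K)"
proof -
  have eq: "cyclotomic_class \<omega> K i = range (\<lambda>j. \<omega> powi (i + int K * j))"
    unfolding cyclotomic_class_def power_int_power
    by (intro image_cong refl) (simp only: power_int_add omega_nonzero simp_thms)
  show ?thesis
  proof (cases "x \<in> F - {0}")
    case True
    then have x: "x \<in> F" "x \<noteq> 0" by auto
    have "x \<in> cyclotomic_class \<omega> K i \<longleftrightarrow> (\<exists>j. [indF x = i + int K * j] (mod int (Q - 1)))"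
      unfolding eq using indF_cong[OF x] by auto
    also have "\<dots> \<longleftrightarrow> [indF x = i] (mod int K)"
    proof
      assume "\<exists>j. [indF x = i + int K * j] (mod int (Q - 1))"
      then obtain j where "[indF x = i + int K * j] (mod int K)" using assms cong_dvd_modulus by blast
      then show "[indF x = i] (mod int K)" by (simp add: cong_def)
    next
      assume "[indF x = i] (mod int K)"
      then obtain j where "indF x - i = int K * j" by (auto simp: cong_iff_dvd_diff elim: dvdE)
      then have "indF x = i + int K * j" by simp
      then show "\<exists>j. [indF x = i + int K * j] (mod int (Q - 1))" by (metis cong_refl)
    qed
    finally show ?thesis using True by simp
  qed (auto simp: eq omega_powi_in_F)
qed

end

text \<open>The assumption on \<open>2\<close> is where \<open>N dvd (q ^ m - 1) div (q - 1)\<close> enters: it puts the nonzero elements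
  of the prime field into the class \<open>C0\<close>.\<close>

locale cyclotomic_classes = quadratic_extension +
  fixes N :: nat
  assumes odd_N: "odd N" and N_dvd: "N dvd Q - 1" and two_class: "int N dvd indF 2"
begin

section \<open>Gauss periods as functions of the class modulo N\<close>

definition period :: "int \<Rightarrow> complex" where
  "period i = add_char_sum Q (cyclotomic_class \<omega> N i)"

definition C0 :: "'a set" where "C0 = {v \<in> F - {0}. int N dvd indF v}"

lemma N_pos: "N > 0" using odd_N by (cases N) auto

lemma N_dvd_int: "int N dvd int (Q - 1)" using N_dvd by (simp only: int_dvd_int_iff)

lemma four_N_dvd: "int (4 * N) dvd int (Q\<^sup>2 - 1)"
proof -
  have "4 * N dvd (Q - 1) * (Q + 1)"
    using mult_dvd_mono[OF four_dvd N_dvd] by (simp only: mult.commute[of "Q - 1"])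
  then show ?thesis unfolding card_units of_nat_mult[symmetric] int_dvd_int_iff .
qed

lemma two_N_dvd: "int (2 * N) dvd int (Q - 1)"
proof -
  have "even (Q - 1)" using odd_Q Q_pos by simp
  moreover have "coprime 2 N" using odd_N by simp
  ultimately have "2 * N dvd Q - 1" using N_dvd by (intro divides_mult)
  then show ?thesis by (simp only: int_dvd_int_iff)
qed

lemma
  shows indF_mult_N: "x \<in> F - {0} \<Longrightarrow> y \<in> F - {0} \<Longrightarrow> [indF (x * y) = indF x + indF y] (mod int N)"
    and indF_divide_N: "x \<in> F - {0} \<Longrightarrow> y \<in> F - {0} \<Longrightarrow> [indF (x / y) = indF x - indF y] (mod int N)"
    and indF_power_N: "x \<in> F - {0} \<Longrightarrow> [indF (x ^ k) = int k * indF x] (mod int N)"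
    and indF_nm_N: "y \<noteq> 0 \<Longrightarrow> [indF (nm y) = ind y] (mod int N)"
    and indF_omega_N: "[indF (\<omega> powi j) = j] (mod int N)"
  by (rule cong_dvd_modulus[OF _ N_dvd_int], rule indF_mult indF_divide indF_power indF_nm indF_omega, assumption+)+
    (rule cong_dvd_modulus[OF indF_omega N_dvd_int])

lemma one_class: "int N dvd indF 1"
  using indF_omega_N[of 0] by (simp add: cong_0_iff)

text \<open>Twice this logarithm is one of 1, hence divisible by N, and N is odd.\<close>

lemma minus_one_class: "int N dvd indF (- 1)"
proof -
  have "[indF ((- 1)\<^sup>2) = int 2 * indF (- 1)] (mod int N)" by (rule indF_power_N) (simp add: F_minus)
  then have "int N dvd 2 * indF (- 1)" using one_class by (simp add: cong_dvd_iff)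
  moreover have "coprime (int N) 2" using odd_N by simp
  ultimately show ?thesis by (simp add: coprime_dvd_mult_right_iff)
qed

lemma ind_minus_1_N: "int N dvd ind (- 1)"
proof -
  have "nm (- 1) = 1" using odd_Q by (simp add: nm_def)
  then have "[indF 1 = ind (- 1)] (mod int N)" using indF_nm_N[of "- 1"] by simp
  then show ?thesis using one_class by (simp add: cong_dvd_iff)
qed

lemma period_cong: "[i = j] (mod int N) \<Longrightarrow> period i = period j"
proof -
  assume ij: "[i = j] (mod int N)"
  have "cyclotomic_class \<omega> N i = cyclotomic_class \<omega> N j"
    unfolding set_eq_iff mem_cyclotomic_class_omega[OF N_dvd_int] using ij by (simp add: cong_def)
  then show ?thesis by (simp add: period_def)
qed

lemma bij_class: assumes z: "z \<in> F - {0}"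
  shows "bij_betw (\<lambda>v. z * v) C0 {x \<in> F - {0}. [indF x = indF z] (mod int N)}"
proof (rule bij_betw_byWitness[where f' = "\<lambda>x. x / z"])
  show "(\<lambda>v. z * v) ` C0 \<subseteq> {x \<in> F - {0}. [indF x = indF z] (mod int N)}"
  proof (rule image_subsetI)
    fix v assume v: "v \<in> C0"
    then have "[indF (z * v) = indF z + indF v] (mod int N)" using z by (intro indF_mult_N) (auto simp: C0_def)
    also have "[indF z + indF v = indF z + 0] (mod int N)"
      using v by (intro cong_add cong_refl) (simp add: C0_def cong_0_iff)
    finally show "z * v \<in> {x \<in> F - {0}. [indF x = indF z] (mod int N)}"
      using v z by (auto simp: C0_def F_mult)
  qed
  show "(\<lambda>x. x / z) ` {x \<in> F - {0}. [indF x = indF z] (mod int N)} \<subseteq> C0"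
  proof (rule image_subsetI)
    fix x assume x: "x \<in> {x \<in> F - {0}. [indF x = indF z] (mod int N)}"
    then have "[indF (x / z) = indF x - indF z] (mod int N)" using z by (intro indF_divide_N) auto
    also have "[indF x - indF z = 0] (mod int N)" using x by (simp add: cong_0_iff cong_iff_dvd_diff)
    finally show "x / z \<in> C0" using x z by (auto simp: C0_def cong_0_iff F_divide)
  qed
qed (use z in auto)

text \<open>The class of z is the coset of \<open>C0\<close> containing z. In this form a period is
  a sum of characters and can be transformed term by term.\<close>

lemma sum_C0_period: assumes z: "z \<in> F - {0}" shows "(\<Sum>v\<in>C0. \<psi> (z * v)) = period (indF z)"
proof -
  have "period (indF z) = (\<Sum>x\<in>{x \<in> F - {0}. [indF x = indF z] (mod int N)}. \<psi> x)"
    unfolding period_def add_char_sum_def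
    by (rule sum.cong) (auto simp: mem_cyclotomic_class_omega[OF N_dvd_int])
  also have "\<dots> = (\<Sum>v\<in>C0. \<psi> (z * v))"
    by (rule sum.reindex_bij_betw[OF bij_class[OF z], symmetric])
  finally show ?thesis by simp
qed

lemma sum_indF:
  fixes K :: "int \<Rightarrow> complex"
  shows "(\<Sum>z\<in>F - {0}. K (indF z mod int N)) = of_nat (card C0) * (\<Sum>i\<in>{0..<int N}. K i)"
proof -
  have "(\<Sum>z\<in>F - {0}. K (indF z mod int N))
      = (\<Sum>i\<in>{0..<int N}. \<Sum>z\<in>{z \<in> F - {0}. indF z mod int N = i}. K (indF z mod int N))"
    by (rule sum.group[symmetric]) (use N_pos in auto)
  also have "\<dots> = (\<Sum>i\<in>{0..<int N}. of_nat (card C0) * K i)"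
  proof (rule sum.cong[OF refl])
    fix i assume i: "i \<in> {0..<int N}"
    have w: "\<omega> powi i \<in> F - {0}" by (simp add: omega_powi_in_F)
    have "{z \<in> F - {0}. indF z mod int N = i} = {x \<in> F - {0}. [indF x = indF (\<omega> powi i)] (mod int N)}"
      using indF_omega_N[of i] i by (auto simp: cong_def)
    then have card: "card {z \<in> F - {0}. indF z mod int N = i} = card C0"
      using bij_betw_same_card[OF bij_class[OF w]] by simp
    have "(\<Sum>z\<in>{z \<in> F - {0}. indF z mod int N = i}. K (indF z mod int N))
        = (\<Sum>z\<in>{z \<in> F - {0}. indF z mod int N = i}. K i)" by (rule sum.cong) auto
    then show "(\<Sum>z\<in>{z \<in> F - {0}. indF z mod int N = i}. K (indF z mod int N)) = of_nat (card C0) * K i"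
      by (simp only: sum_constant card)
  qed
  finally show ?thesis by (simp add: sum_distrib_left)
qed

lemma card_C0: "card C0 * N = Q - 1"
proof -
  have "(of_nat (Q - 1) :: complex) = of_nat (card C0 * N)"
    using sum_indF[of "\<lambda>_. 1"] by (simp add: card_F_units)
  then show ?thesis by (simp only: of_nat_eq_iff)
qed


section \<open>The hypothesis as one twisted sum, and membership in \<open>D_set\<close>\<close>

definition part_sign :: "int set \<Rightarrow> int set \<Rightarrow> int \<Rightarrow> complex" where
  "part_sign S1 S2 i = (if i \<in> S1 then 1 else if i \<in> S2 then - 1 else 0)"

definition twisted_period :: "int set \<Rightarrow> int set \<Rightarrow> int \<Rightarrow> complex" where
  "twisted_period S1 S2 c =
     (\<Sum>z\<in>F - {0}. \<eta> z * part_sign S1 S2 ((2 * indF z) mod int N) * \<psi> (\<omega> powi c * z))"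

text \<open>The four residues \<open>N i mod 4\<close> are split as in \<open>Y_index\<close>: \<open>i \<in> {0, 3}\<close> goes with \<open>S1\<close>, \<open>i \<in> {1, 2}\<close> with \<open>S2\<close>.\<close>

definition \<chi> :: "int \<Rightarrow> complex" where
  "\<chi> k = (if k mod 4 \<in> {0, (3 * int N) mod 4} then 1 else - 1)"

lemma N_mod_4: "(3 * int N) mod 4 = 1 \<and> int N mod 4 = 3 \<or> (3 * int N) mod 4 = 3 \<and> int N mod 4 = 1"
proof -
  have "odd (int N)" using odd_N by simp
  then show ?thesis by presburger
qed

text \<open>As 2 is 2N modulo 4, adding 2 exchanges the residues {0, 3N} with {2N, N}.\<close>

lemma chi_anti: "\<chi> (k + 2) = - \<chi> k"
proof -
  have "(k + 2) mod 4 \<in> {0, (3 * int N) mod 4} \<longleftrightarrow> k mod 4 \<notin> {0, (3 * int N) mod 4}"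
    using N_mod_4 by (elim disjE conjE; simp only: insert_iff empty_iff; presburger)
  then show ?thesis by (simp only: \<chi>_def) simp
qed

text \<open>Since N is odd, 0, N, 2N, 3N run through all residues modulo 4. The pair {0, 3} is where
  \<chi> is 1, {1, 2} is where it is not, and all four values together impose no condition.\<close>

lemma mem_D_set:
  assumes I: "I1 \<subseteq> {0..<int N}" "S1 \<subseteq> {0..<int N}" "S2 \<subseteq> {0..<int N}"
  shows "x \<in> D_set \<gamma> N I1 S1 S2 \<longleftrightarrow> x \<noteq> 0 \<and>
    (ind x mod int N \<in> S1 \<and> \<chi> (ind x) = 1 \<or> ind x mod int N \<in> S2 \<and> \<chi> (ind x) \<noteq> 1 \<or> ind x mod int N \<in> I1)"
proof -
  define e where "e = ind x"
  have "odd (int N)" using odd_N by simp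
  then have N2: "(2 * int N) mod 4 = 2" by presburger
  have c1: "\<chi> e = 1 \<longleftrightarrow> (\<exists>i\<in>{0, 3}. [e = int N * i] (mod 4))"
    unfolding \<chi>_def cong_def by (simp add: mult.commute)
  have c2: "\<chi> e \<noteq> 1 \<longleftrightarrow> (\<exists>i\<in>{1, 2}. [e = int N * i] (mod 4))"
  proof -
    have "e mod 4 \<noteq> 0 \<and> e mod 4 \<noteq> (3 * int N) mod 4 \<longleftrightarrow> e mod 4 = int N mod 4 \<or> e mod 4 = (2 * int N) mod 4"
      unfolding N2 using N_mod_4 by (elim disjE conjE; simp only:; presburger)
    moreover have "\<chi> e \<noteq> 1 \<longleftrightarrow> e mod 4 \<noteq> 0 \<and> e mod 4 \<noteq> (3 * int N) mod 4"
      unfolding \<chi>_def by simp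
    moreover have "(\<exists>i\<in>{1, 2}. [e = int N * i] (mod 4)) \<longleftrightarrow> e mod 4 = int N mod 4 \<or> e mod 4 = (2 * int N) mod 4"
      by (simp add: cong_def mult.commute)
    ultimately show ?thesis by (simp only:)
  qed
  have c3: "\<exists>i\<in>{0, 1, 2, 3}. [e = int N * i] (mod 4)"
    using c1 c2 by blast
  have "x \<in> D_set \<gamma> N I1 S1 S2 \<longleftrightarrow> x \<noteq> 0 \<and> (\<exists>i\<in>Y_index N I1 S1 S2. [e = i] (mod 4 * int N))"
    unfolding D_set_def e_def UN_iff mem_cyclotomic_class[OF four_N_dvd] of_nat_mult of_nat_numeral by blast
  also have "(\<exists>i\<in>Y_index N I1 S1 S2. [e = i] (mod 4 * int N)) \<longleftrightarrow>
      (\<exists>i\<in>{0, 3}. \<exists>j\<in>inv_scale N 4 S1. [e = int N * i + 4 * j] (mod 4 * int N)) \<or>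
      (\<exists>i\<in>{1, 2}. \<exists>j\<in>inv_scale N 4 S2. [e = int N * i + 4 * j] (mod 4 * int N)) \<or>
      (\<exists>i\<in>{0, 1, 2, 3}. \<exists>j\<in>inv_scale N 4 I1. [e = int N * i + 4 * j] (mod 4 * int N))"
    unfolding Y_index_def bex_simps(7) bex_Un split_paired_Bex_Sigma case_prod_conv cong_mod_right disj_assoc ..
  also have "\<dots> \<longleftrightarrow> e mod int N \<in> S1 \<and> \<chi> e = 1 \<or> e mod int N \<in> S2 \<and> \<chi> e \<noteq> 1 \<or> e mod int N \<in> I1"
    unfolding Y_index_cong[OF odd_N I(1)] Y_index_cong[OF odd_N I(2)] Y_index_cong[OF odd_N I(3)]
    using c1 c2 c3 by blast
  finally show ?thesis by (simp only: e_def)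
qed

lemma mem_inv_scale_2:
  assumes "I \<subseteq> {0..<int N}"
  shows "c mod int N \<in> inv_scale N 2 I \<longleftrightarrow> (2 * c) mod int N \<in> I"
proof -
  have cop: "coprime 2 (int N)" using odd_N by simp
  show ?thesis
    unfolding mem_inv_scale_iff[OF cop N_pos assms] using N_pos by (simp add: mod_mult_right_eq)
qed

text \<open>Where 2 \<open>indF z\<close> lies in \<open>S1\<close>, membership in the first union
  means an even logarithm, and for \<open>S2\<close> an odd one. Twice the first indicator minus the
  second is therefore \<eta> on \<open>S1\<close>, -\<eta> on \<open>S2\<close> and 0
  elsewhere.\<close>

lemma twisted_period_eq:
  assumes S: "S1 \<union> S2 = I2" "S1 \<inter> S2 = {}" and I: "I2 \<subseteq> {0..<int N}"
  shows "2 * add_char_sum Q ((*) (\<omega> powi c) ` (\<Union>l\<in>X_index N S1 S2. cyclotomic_class \<omega> (2 * N) l))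
      - add_char_sum Q ((*) (\<omega> powi c) ` (\<Union>l\<in>inv_scale N 2 I2. cyclotomic_class \<omega> N l))
    = twisted_period S1 S2 c"
proof -
  let ?X = "\<Union>l\<in>X_index N S1 S2. cyclotomic_class \<omega> (2 * N) l"
  let ?Y = "\<Union>l\<in>inv_scale N 2 I2. cyclotomic_class \<omega> N l"
  have S': "S1 \<subseteq> {0..<int N}" "S2 \<subseteq> {0..<int N}" using S I by auto
  have image: "add_char_sum Q ((*) (\<omega> powi c) ` A) = (\<Sum>z\<in>A. \<psi> (\<omega> powi c * z))" for A
    unfolding add_char_sum_def by (subst sum.reindex) (auto simp: inj_on_def)
  have X: "z \<in> ?X \<longleftrightarrow> z \<in> F - {0} \<and>
      (even (indF z) \<and> (2 * indF z) mod int N \<in> S1 \<or> odd (indF z) \<and> (2 * indF z) mod int N \<in> S2)" for z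
    using X_index_cong[OF odd_N S', of "indF z"] by (simp only: UN_iff mem_cyclotomic_class_omega[OF two_N_dvd]) blast
  have Y: "z \<in> ?Y \<longleftrightarrow> z \<in> F - {0} \<and> (2 * indF z) mod int N \<in> I2" for z
  proof -
    have "(\<exists>l\<in>inv_scale N 2 I2. [indF z = l] (mod int N)) \<longleftrightarrow> indF z mod int N \<in> inv_scale N 2 I2"
    proof
      assume "\<exists>l\<in>inv_scale N 2 I2. [indF z = l] (mod int N)"
      then obtain l where l: "l \<in> inv_scale N 2 I2" "[indF z = l] (mod int N)" by blast
      then have "l mod int N = l" using N_pos by (auto simp: inv_scale_def)
      then show "indF z mod int N \<in> inv_scale N 2 I2" using l by (simp add: cong_def)
    next
      assume "indF z mod int N \<in> inv_scale N 2 I2"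
      then show "\<exists>l\<in>inv_scale N 2 I2. [indF z = l] (mod int N)" by (rule bexI[rotated]) (simp add: cong_def)
    qed
    then show ?thesis
      using mem_inv_scale_2[OF I, of "indF z"] by (simp only: UN_iff mem_cyclotomic_class_omega[OF N_dvd_int]) blast
  qed
  have restrict: "(\<Sum>z\<in>A. \<psi> (\<omega> powi c * z)) = (\<Sum>z\<in>F - {0}. if z \<in> A then \<psi> (\<omega> powi c * z) else 0)"
    if "A \<subseteq> F - {0}" for A
    using that by (simp add: sum.inter_restrict[symmetric] inf.absorb2)
  have "?X \<subseteq> F - {0}" "?Y \<subseteq> F - {0}" using X Y by blast+
  then have "2 * add_char_sum Q ((*) (\<omega> powi c) ` ?X) - add_char_sum Q ((*) (\<omega> powi c) ` ?Y)
      = (\<Sum>z\<in>F - {0}. 2 * (if z \<in> ?X then \<psi> (\<omega> powi c * z) else 0) - (if z \<in> ?Y then \<psi> (\<omega> powi c * z) else 0))"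
    unfolding image by (simp only: restrict sum_subtractf sum_distrib_left)
  also have "\<dots> = twisted_period S1 S2 c"
    unfolding twisted_period_def
  proof (rule sum.cong[OF refl])
    fix z assume z: "z \<in> F - {0}"
    show "2 * (if z \<in> ?X then \<psi> (\<omega> powi c * z) else 0) - (if z \<in> ?Y then \<psi> (\<omega> powi c * z) else 0)
        = \<eta> z * part_sign S1 S2 ((2 * indF z) mod int N) * \<psi> (\<omega> powi c * z)"
      unfolding X Y eta_eq[OF z] part_sign_def unfolding S(1)[symmetric] using z S(2) by auto
  qed
  finally show ?thesis .
qed

end

section \<open>Three equally spaced Gauss periods\<close>

text \<open>The hypotheses of the theorem with index sets decoded: membership of c in the halved set
  is stated for 2c, and the difference of character sums is \<open>twisted_period\<close>.\<close>

locale three_valued_periods = cyclotomic_classes +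
  fixes \<alpha>1 \<alpha>2 \<alpha>3 :: rat and I1 I2 S1 S2 :: "int set"
  assumes periods: "period ` {0..<int N} = {of_rat \<alpha>1, of_rat \<alpha>2, of_rat \<alpha>3}"
    and step: "\<alpha>1 - \<alpha>2 = \<alpha>2 - \<alpha>3" and step_pos: "\<alpha>2 - \<alpha>3 > 0"
    and I1: "I1 = {i \<in> {0..<int N}. period i = of_rat \<alpha>1}"
    and I2: "I2 = {i \<in> {0..<int N}. period i = of_rat \<alpha>2}"
    and S_Un: "S1 \<union> S2 = I2" and S_Int: "S1 \<inter> S2 = {}"
    and twisted: "\<And>c. if (2 * c) mod int N \<in> I2
        then twisted_period S1 S2 c = gauss_sum Q (quadratic_char Q :: 'a \<Rightarrow> complex)
          \<or> twisted_period S1 S2 c = - gauss_sum Q (quadratic_char Q :: 'a \<Rightarrow> complex)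
        else twisted_period S1 S2 c = 0"
begin

lemma mem_I1: "i \<in> I1 \<longleftrightarrow> i \<in> {0..<int N} \<and> period i = of_rat \<alpha>1"
  and mem_I2: "i \<in> I2 \<longleftrightarrow> i \<in> {0..<int N} \<and> period i = of_rat \<alpha>2"
  unfolding I1 I2 by blast+

lemma values_less: "\<alpha>2 < \<alpha>1" "\<alpha>3 < \<alpha>2"
proof -
  show "\<alpha>3 < \<alpha>2" using step_pos by (simp only: diff_gt_0_iff_gt)
  have "\<alpha>1 - \<alpha>2 > 0" unfolding step by (rule step_pos)
  then show "\<alpha>2 < \<alpha>1" by (simp only: diff_gt_0_iff_gt)
qed

text \<open>A trivial character would give every period the value \<open>card C0\<close>, while
  distinct values are attained.\<close>

lemma nontrivial: "\<exists>x\<in>F. \<psi> x \<noteq> 1"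
proof (rule ccontr)
  assume "\<not> (\<exists>x\<in>F. \<psi> x \<noteq> 1)"
  then have triv: "\<psi> x = 1" if "x \<in> F" for x using that by blast
  have const: "period i = of_nat (card C0)" for i
  proof -
    have w: "\<omega> powi i \<in> F - {0}" by (simp add: omega_powi_in_F)
    have "period i = (\<Sum>v\<in>C0. \<psi> (\<omega> powi i * v))"
      unfolding sum_C0_period[OF w] by (rule period_cong) (rule indF_omega_N[THEN cong_sym])
    also have "\<dots> = (\<Sum>v\<in>C0. 1)"
      by (rule sum.cong[OF refl], rule triv) (auto simp: C0_def F_mult omega_powi_in_F)
    finally show ?thesis by simp
  qed
  have "(of_rat \<alpha>2 :: complex) \<in> period ` {0..<int N}" "(of_rat \<alpha>3 :: complex) \<in> period ` {0..<int N}"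
    unfolding periods by auto
  then have "(of_rat \<alpha>2 :: complex) = of_rat \<alpha>3" unfolding const by (elim imageE) (simp only:)
  then show False using step_pos by simp
qed

sublocale quadratic_extension_char \<gamma> Q n
  by unfold_locales (rule nontrivial)

section \<open>The unsigned part of the indicator and the parameter \<open>r\<close>\<close>

definition weight :: "int \<Rightarrow> complex" where
  "weight i = (if i \<in> I1 then 2 else if i \<in> I2 then 1 else 0)"

lemma subsets: "I1 \<subseteq> {0..<int N}" "I2 \<subseteq> {0..<int N}" "S1 \<subseteq> {0..<int N}" "S2 \<subseteq> {0..<int N}"
proof -
  show "I1 \<subseteq> {0..<int N}" "I2 \<subseteq> {0..<int N}" unfolding I1 I2 by blast+
  then show "S1 \<subseteq> {0..<int N}" "S2 \<subseteq> {0..<int N}" using S_Un by blast+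
qed

lemma disjoint: "I1 \<inter> I2 = {}"
  using values_less by (auto simp: mem_I1 mem_I2)

text \<open>Equal spacing makes the weight an affine function of the Gauss period.\<close>

lemma weight_eq:
  "weight (i mod int N) = 1 + (period i - of_rat \<alpha>2) / of_rat (\<alpha>2 - \<alpha>3)"
proof -
  define k where "k = i mod int N"
  have k: "k \<in> {0..<int N}" using N_pos by (simp add: k_def)
  have pk: "period i = period k" by (rule period_cong) (simp add: k_def cong_def)
  have ne: "(of_rat (\<alpha>2 - \<alpha>3) :: complex) \<noteq> 0" using step_pos by simp
  have d: "(of_rat \<alpha>1 - of_rat \<alpha>2 :: complex) = of_rat (\<alpha>2 - \<alpha>3)"
    by (simp only: of_rat_diff[symmetric] step)
  have d3: "(of_rat \<alpha>3 - of_rat \<alpha>2 :: complex) = - of_rat (\<alpha>2 - \<alpha>3)"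
    by (simp only: of_rat_diff) simp
  have lt: "\<alpha>1 \<noteq> \<alpha>2" "\<alpha>1 \<noteq> \<alpha>3" "\<alpha>2 \<noteq> \<alpha>3" using values_less by simp_all
  have "period k \<in> {of_rat \<alpha>1, of_rat \<alpha>2, of_rat \<alpha>3}" using k periods by blast
  then consider "period k = of_rat \<alpha>1" | "period k = of_rat \<alpha>2" | "period k = of_rat \<alpha>3" by blast
  then have "weight k = 1 + (period k - of_rat \<alpha>2) / of_rat (\<alpha>2 - \<alpha>3)"
  proof cases
    case 1
    then have "weight k = 2" using k by (simp add: weight_def mem_I1)
    then show ?thesis unfolding 1 d using ne by simp
  next
    case 2
    then have "weight k = 1" using k lt by (simp add: weight_def mem_I1 mem_I2)
    then show ?thesis unfolding 2 by simp
  next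
    case 3
    then have "weight k = 0" using k lt by (simp add: weight_def mem_I1 mem_I2)
    then show ?thesis unfolding 3 d3 using ne by simp
  qed
  then show ?thesis by (simp only: pk k_def)
qed

text \<open>The division is exact: \<open>card C0\<close> is (Q - 1)/N with Q and N odd, hence
  even.\<close>

definition r :: nat where "r = card C0 div 2 * (2 * card I1 + card I2)"

lemma even_card_C0: "even (card C0)"
proof -
  have "even (card C0 * N)" unfolding card_C0 using odd_Q Q_pos by simp
  then show ?thesis using odd_N by simp
qed

lemma two_r: "2 * r = card C0 * (2 * card I1 + card I2)"
  using even_card_C0 unfolding r_def by (metis mult.assoc dvd_mult_div_cancel)

lemma of_nat_r:
  "(of_nat r :: 'b::field_char_0) = (of_nat Q - 1) * (2 * of_nat (card I1) + of_nat (card I2)) / (2 * of_nat N)"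
proof -
  have "N * (2 * r) = (Q - 1) * (2 * card I1 + card I2)"
    unfolding two_r card_C0[symmetric] by (simp only: ac_simps)
  then have "(of_nat (N * (2 * r)) :: 'b) = of_nat ((Q - 1) * (2 * card I1 + card I2))" by (simp only:)
  then have "2 * of_nat N * (of_nat r :: 'b) = (of_nat Q - 1) * (2 * of_nat (card I1) + of_nat (card I2))"
    using Q_pos by (simp add: of_nat_diff ac_simps)
  then show ?thesis using N_pos by (simp add: field_simps)
qed

lemma sum_weight: "(\<Sum>z\<in>F - {0}. weight (indF z mod int N)) = 2 * of_nat r"
proof -
  have "(\<Sum>i\<in>{0..<int N}. weight i) =
      (\<Sum>i\<in>{0..<int N}. 2 * (if i \<in> I1 then 1 else 0) + (if i \<in> I2 then 1 else 0))"
    by (rule sum.cong) (use disjoint in \<open>auto simp: weight_def\<close>)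
  also have "\<dots> = 2 * of_nat (card I1) + of_nat (card I2)"
    using subsets by (simp add: sum.distrib sum_distrib_left[symmetric] inf.absorb2 flip: sum.inter_restrict)
  finally have "(\<Sum>z\<in>F - {0}. weight (indF z mod int N)) = of_nat (card C0 * (2 * card I1 + card I2))"
    by (simp add: sum_indF)
  then show ?thesis by (simp only: two_r[symmetric]) simp
qed

text \<open>A second evaluation of the total weight, through its affine expression in the periods.
  The periods sum to -\<open>card C0\<close> over the units of \<open>F\<close>, because each v in
  \<open>C0\<close> contributes a complete character sum without the term at 0.\<close>

lemma two_r_periods:
  "(2 * of_nat r :: complex) = (of_nat Q - 1) * (1 - of_rat \<alpha>2 / of_rat (\<alpha>2 - \<alpha>3)) - of_nat (card C0) / of_rat (\<alpha>2 - \<alpha>3)"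
proof -
  let ?d = "of_rat (\<alpha>2 - \<alpha>3) :: complex"
  have "(\<Sum>z\<in>F - {0}. period (indF z)) = (\<Sum>z\<in>F - {0}. \<Sum>v\<in>C0. \<psi> (v * z))"
    by (rule sum.cong[OF refl]) (simp only: sum_C0_period[symmetric] mult.commute)
  also have "\<dots> = (\<Sum>v\<in>C0. \<Sum>z\<in>F - {0}. \<psi> (v * z))" by (rule sum.swap)
  also have "\<dots> = (\<Sum>v\<in>C0. - 1)"
    by (rule sum.cong[OF refl], subst sum_psi_units) (auto simp: C0_def)
  finally have P: "(\<Sum>z\<in>F - {0}. period (indF z)) = - of_nat (card C0)" by simp
  have "2 * of_nat r = (\<Sum>z\<in>F - {0}. (1 - of_rat \<alpha>2 / ?d) + period (indF z) / ?d)"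
    unfolding sum_weight[symmetric] weight_eq by (rule sum.cong[OF refl]) (simp add: diff_divide_distrib)
  also have "\<dots> = of_nat (Q - 1) * (1 - of_rat \<alpha>2 / ?d) + (\<Sum>z\<in>F - {0}. period (indF z)) / ?d"
    by (simp only: sum.distrib sum_divide_distrib[symmetric] sum_constant card_F_units)
  finally show ?thesis using Q_pos by (simp add: P of_nat_diff)
qed

text \<open>For nonzero x the period is the sum over v in \<open>C0\<close> of \<psi>(v nm(x)), and
  \<open>sum_psi_nm\<close> transforms each term into -Q \<psi>(-nm(y)/v). The map v to -1/v
  permutes \<open>C0\<close>, so the period reappears; the constant comes from omitting x =
  0.\<close>

lemma sum_period_psi:
  assumes y: "y \<noteq> 0"
  shows "(\<Sum>x\<in>- {0}. period (ind x) * \<psi> (tr (y * x))) = - of_nat Q * period (ind y) - of_nat (card C0)"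
proof -
  have per: "period (ind x) = (\<Sum>v\<in>C0. \<psi> (nm x * v))" if "x \<noteq> 0" for x
  proof -
    have "(\<Sum>v\<in>C0. \<psi> (nm x * v)) = period (indF (nm x))" using that by (intro sum_C0_period) simp
    also have "\<dots> = period (ind x)" using that by (intro period_cong indF_nm_N)
    finally show ?thesis by simp
  qed
  have "(\<Sum>x\<in>- {0}. period (ind x) * \<psi> (tr (y * x)))
      = (\<Sum>x\<in>- {0}. \<Sum>v\<in>C0. \<psi> (v * nm x) * \<psi> (tr (y * x)))"
  proof (rule sum.cong[OF refl])
    fix x :: 'a assume "x \<in> - {0}"
    then have x: "x \<noteq> 0" by simp
    show "period (ind x) * \<psi> (tr (y * x)) = (\<Sum>v\<in>C0. \<psi> (v * nm x) * \<psi> (tr (y * x)))"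
      unfolding per[OF x] sum_distrib_right by (simp only: mult.commute[of "nm x"])
  qed
  also have "\<dots> = (\<Sum>v\<in>C0. \<Sum>x\<in>- {0}. \<psi> (v * nm x) * \<psi> (tr (y * x)))" by (rule sum.swap)
  also have "\<dots> = (\<Sum>v\<in>C0. - of_nat Q * \<psi> (nm y * (- 1 / v)) - 1)"
  proof (rule sum.cong[OF refl])
    fix v assume v: "v \<in> C0"
    have "(\<Sum>x\<in>UNIV. \<psi> (v * nm x) * \<psi> (tr (y * x)))
        = \<psi> (v * nm 0) * \<psi> (tr (y * 0)) + (\<Sum>x\<in>UNIV - {0}. \<psi> (v * nm x) * \<psi> (tr (y * x)))"
      by (rule sum.remove) auto
    moreover have "tr 0 = 0" "nm 0 = 0" using Q_pos by (simp_all add: tr_def nm_def zero_power)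
    moreover have "UNIV - {0} = - {0 :: 'a}" by auto
    ultimately show "(\<Sum>x\<in>- {0}. \<psi> (v * nm x) * \<psi> (tr (y * x))) = - of_nat Q * \<psi> (nm y * (- 1 / v)) - 1"
      using sum_psi_nm[of v y] v by (simp add: C0_def eq_diff_eq add.commute)
  qed
  also have "\<dots> = - of_nat Q * (\<Sum>v\<in>C0. \<psi> (nm y * (- 1 / v))) - of_nat (card C0)"
    by (simp only: sum_subtractf sum_distrib_left[symmetric]) simp
  also have "(\<Sum>v\<in>C0. \<psi> (nm y * (- 1 / v))) = (\<Sum>v\<in>C0. \<psi> (nm y * v))"
  proof -
    have "- 1 / v \<in> C0" if v: "v \<in> C0" for v
    proof -
      have "[indF (- 1 / v) = indF (- 1) - indF v] (mod int N)"
        using v by (intro indF_divide_N) (auto simp: C0_def F_minus)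
      moreover have "int N dvd indF (- 1) - indF v" using v minus_one_class by (simp add: C0_def)
      ultimately have "int N dvd indF (- 1 / v)" by (simp only: cong_dvd_iff)
      moreover have "- 1 / v \<in> F - {0}" using v F_divide[of "- 1" v] by (auto simp: C0_def F_minus)
      ultimately show ?thesis by (simp add: C0_def)
    qed
    then show ?thesis
      by (intro sum.reindex_bij_witness[of _ "\<lambda>v. - 1 / v" "\<lambda>v. - 1 / v"]) auto
  qed
  also have "\<dots> = period (ind y)" using per[OF y] by simp
  finally show ?thesis .
qed

text \<open>The weight is affine in the period, so its transform follows from those of the period
  and of a constant. \<open>two_r_periods\<close> identifies the resulting constant as 2r.\<close>

lemma sum_weight_psi:
  assumes y: "y \<noteq> 0"
  shows "(\<Sum>x\<in>- {0}. weight (ind x mod int N) * \<psi> (tr (y * x)))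
    = 2 * of_nat r - of_nat Q * weight (ind y mod int N)"
proof -
  let ?d = "of_rat (\<alpha>2 - \<alpha>3) :: complex"
  have "(\<Sum>x\<in>UNIV. \<psi> (tr (y * x))) = \<psi> (tr (y * 0)) + (\<Sum>x\<in>UNIV - {0}. \<psi> (tr (y * x)))"
    by (rule sum.remove) auto
  moreover have "tr 0 = 0" using Q_pos by (simp add: tr_def zero_power)
  moreover have "UNIV - {0} = - {0 :: 'a}" by auto
  ultimately have s: "(\<Sum>x\<in>- {0}. \<psi> (tr (y * x))) = - 1"
    using y by (simp add: sum_psi_tr add_eq_0_iff)
  have "(\<Sum>x\<in>- {0}. weight (ind x mod int N) * \<psi> (tr (y * x)))
      = (\<Sum>x\<in>- {0}. (1 - of_rat \<alpha>2 / ?d) * \<psi> (tr (y * x)) + period (ind x) * \<psi> (tr (y * x)) / ?d)"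
    unfolding weight_eq by (rule sum.cong[OF refl]) (simp add: diff_divide_distrib algebra_simps)
  also have "\<dots> = (1 - of_rat \<alpha>2 / ?d) * (\<Sum>x\<in>- {0}. \<psi> (tr (y * x)))
      + (\<Sum>x\<in>- {0}. period (ind x) * \<psi> (tr (y * x))) / ?d"
    by (simp only: sum.distrib sum_divide_distrib[symmetric] sum_distrib_left[symmetric])
  also have "\<dots> = 2 * of_nat r - of_nat Q * weight (ind y mod int N)"
    unfolding s sum_period_psi[OF y] two_r_periods weight_eq
  proof -
    \<comment> \<open>What remains is an algebraic identity, proved for arbitrary complex numbers;
      it also holds for d = 0, where quotients are 0.\<close>
    show "(1 - a / d) * - 1 + (- q * p - k) / d = (q - 1) * (1 - a / d) - k / d - q * (1 + (p - a) / d)"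
      for a d q p k :: complex
      by (cases "d = 0") (simp_all add: field_simps)
  qed
  finally show ?thesis .
qed

text \<open>\<open>twisted_sum\<close> leaves a sum over \<open>F\<close> that involves nm(y).
  Scaling z by an element v whose square lies in the class of nm(y) turns it into \<eta>(v) times a
  twisted period, and the two factors \<plusminus>G multiply to \<plusminus>Q.\<close>

lemma sum_chi_psi:
  assumes y: "y \<noteq> 0"
  defines "T \<equiv> (\<Sum>x\<in>- {0}. \<chi> (ind x) * part_sign S1 S2 (ind x mod int N) * \<psi> (tr (y * x)))"
  shows "if ind y mod int N \<in> I2 then T = of_nat Q \<or> T = - of_nat Q else T = 0"
proof -
  define g where "g z = part_sign S1 S2 (indF z mod int N)" for z
  have g_cong: "g a = g b" if "[indF a = indF b] (mod int N)" for a b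
    using that by (simp add: g_def cong_def)
  have "coprime 2 (int N)" using odd_N by simp
  \<comment> \<open>The number b halves logarithms modulo the odd N, so that v^2 has the class of
    nm(y).\<close>
  then obtain b where "[2 * b = 1] (mod int N)" using cong_solve_coprime_int by blast
  then have b: "[2 * (b * ind y) = ind y] (mod int N)"
    using cong_scalar_right[of "2 * b" 1 "int N" "ind y"] by (simp add: mult.assoc)
  define v where "v = \<omega> powi (b * ind y)"
  have v: "v \<in> F - {0}" by (simp add: v_def omega_powi_in_F)
  have indv: "[indF v = b * ind y] (mod int N)" unfolding v_def by (rule indF_omega_N)
  have mem: "- 2 \<in> F - {0}" using F_numeral F_minus by simp
  \<comment> \<open>This exponent absorbs the factor -2v of the character argument. Since -2 lies in
    class 0, 2c and \<open>ind y\<close> agree modulo N.\<close>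
  define c where "c = indF (- 2 * v)"
  have m2v: "- 2 * v \<in> F" "- 2 * v \<noteq> 0" using v F_mult[of "- 2" v] mem by auto
  have powc: "\<omega> powi c = - 2 * v" unfolding c_def using m2v by (rule indF_powi)
  have "[indF (- 2) = indF (- 1) + indF 2] (mod int N)"
    using indF_mult_N[of "- 1" 2] by (simp add: F_minus F_numeral)
  moreover have "int N dvd indF (- 1) + indF 2" using minus_one_class two_class by simp
  ultimately have m2: "int N dvd indF (- 2)" by (simp only: cong_dvd_iff)
  have "[c = indF (- 2) + indF v] (mod int N)" unfolding c_def using mem v by (rule indF_mult_N)
  also have "[indF (- 2) + indF v = 0 + b * ind y] (mod int N)"
    using m2 indv by (intro cong_add) (simp_all add: cong_0_iff)
  finally have "[2 * c = 2 * (b * ind y)] (mod int N)" by (intro cong_scalar_left) simp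
  then have c: "(2 * c) mod int N = ind y mod int N" using b by (simp add: cong_def)
  have "T = (\<Sum>x\<in>- {0}. \<chi> (ind x) * g (nm x) * \<psi> (tr (y * x)))"
    unfolding T_def
  proof (rule sum.cong[OF refl])
    fix x :: 'a assume "x \<in> - {0}"
    then have "g (nm x) = part_sign S1 S2 (ind x mod int N)"
      using indF_nm_N[of x] by (simp add: g_def cong_def)
    then show "\<chi> (ind x) * part_sign S1 S2 (ind x mod int N) * \<psi> (tr (y * x))
        = \<chi> (ind x) * g (nm x) * \<psi> (tr (y * x))" by simp
  qed
  also have "\<dots> = \<chi> (- ind y) * G * (\<Sum>z\<in>F - {0}. \<eta> z * g (z\<^sup>2 / nm y) * \<psi> (- 2 * z))"
    by (rule twisted_sum[where \<chi> = \<chi> and g = g and y = y, OF chi_anti y])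
  also have "(\<Sum>z\<in>F - {0}. \<eta> z * g (z\<^sup>2 / nm y) * \<psi> (- 2 * z))
      = (\<Sum>z\<in>F - {0}. \<eta> (v * z) * g ((v * z)\<^sup>2 / nm y) * \<psi> (- 2 * (v * z)))"
    by (rule sum_F_units_scale[OF v, symmetric])
  also have "\<dots> = (\<Sum>z\<in>F - {0}. \<eta> v * (\<eta> z * part_sign S1 S2 ((2 * indF z) mod int N) * \<psi> (\<omega> powi c * z)))"
  proof (rule sum.cong[OF refl])
    fix z assume z: "z \<in> F - {0}"
    have sq: "(v * z)\<^sup>2 \<in> F - {0}" and vz: "v * z \<in> F - {0}" using v z by (auto simp: F_mult F_power)
    have nmy: "nm y \<in> F - {0}" using y by simp
    have "[indF ((v * z)\<^sup>2 / nm y) = indF ((v * z)\<^sup>2) - indF (nm y)] (mod int N)"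
      using sq nmy by (rule indF_divide_N)
    also have "[indF ((v * z)\<^sup>2) - indF (nm y) = int 2 * indF (v * z) - ind y] (mod int N)"
      using vz y by (intro cong_diff indF_power_N indF_nm_N)
    also have "[int 2 * indF (v * z) - ind y = int 2 * (b * ind y + indF z) - ind y] (mod int N)"
      using cong_trans[OF indF_mult_N[OF v z] cong_add[OF indv cong_refl]]
      by (intro cong_diff cong_refl cong_scalar_left)
    also have "int 2 * (b * ind y + indF z) - ind y = 2 * (b * ind y) + (2 * indF z - ind y)" by simp
    also have "[2 * (b * ind y) + (2 * indF z - ind y) = ind y + (2 * indF z - ind y)] (mod int N)"
      by (rule cong_add[OF b cong_refl])
    finally have "g ((v * z)\<^sup>2 / nm y) = part_sign S1 S2 ((2 * indF z) mod int N)"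
      by (simp add: g_def cong_def)
    then show "\<eta> (v * z) * g ((v * z)\<^sup>2 / nm y) * \<psi> (- 2 * (v * z))
        = \<eta> v * (\<eta> z * part_sign S1 S2 ((2 * indF z) mod int N) * \<psi> (\<omega> powi c * z))"
      using v z by (simp add: eta_mult powc mult.assoc)
  qed
  also have "\<dots> = \<eta> v * twisted_period S1 S2 c"
    by (simp only: twisted_period_def sum_distrib_left)
  finally have T: "T = (\<chi> (- ind y) * \<eta> v) * (G * twisted_period S1 S2 c)" by simp
  have sign: "\<chi> (- ind y) * \<eta> v = 1 \<or> \<chi> (- ind y) * \<eta> v = - 1"
    using v eta_cases[of v] by (auto simp: \<chi>_def)
  have GG: "G * G = - of_nat Q" using G_square by (simp add: power2_eq_square)
  show ?thesis
  proof (cases "ind y mod int N \<in> I2")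
    case True
    then have "twisted_period S1 S2 c = G \<or> twisted_period S1 S2 c = - G"
      using twisted[of c] by (simp add: c gauss_sum_eq)
    then have "G * twisted_period S1 S2 c = of_nat Q \<or> G * twisted_period S1 S2 c = - of_nat Q"
      by (elim disjE) (simp_all only: GG mult_minus_right minus_minus simp_thms)
    with sign have "T = of_nat Q \<or> T = - of_nat Q"
      unfolding T by (elim disjE) (simp_all only: mult_1 mult_minus_left minus_minus simp_thms)
    then show ?thesis using True by (simp only: if_True)
  next
    case False
    then show ?thesis using twisted[of c] by (simp add: c T)
  qed
qed

section \<open>The set \<open>D\<close>: its size, symmetry and character values\<close>

abbreviation D :: "'a set" where "D \<equiv> D_set \<gamma> N I1 S1 S2"

lemma mem_D: "x \<in> D \<longleftrightarrow> x \<noteq> 0 \<and>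
    (ind x mod int N \<in> S1 \<and> \<chi> (ind x) = 1 \<or> ind x mod int N \<in> S2 \<and> \<chi> (ind x) \<noteq> 1 \<or> ind x mod int N \<in> I1)"
  by (rule mem_D_set) (rule subsets)+

lemma sum_D:
  fixes K :: "'a \<Rightarrow> complex"
  shows "2 * (\<Sum>x\<in>D. K x) = (\<Sum>x\<in>- {0}. weight (ind x mod int N) * K x)
    + (\<Sum>x\<in>- {0}. \<chi> (ind x) * part_sign S1 S2 (ind x mod int N) * K x)"
proof -
  have "D \<subseteq> - {0}" using mem_D by auto
  then have "(\<Sum>x\<in>D. K x) = (\<Sum>x\<in>- {0}. if x \<in> D then K x else 0)"
    by (simp add: sum.inter_restrict[symmetric] inf.absorb2)
  then have "2 * (\<Sum>x\<in>D. K x) = (\<Sum>x\<in>- {0}. 2 * (if x \<in> D then K x else 0))"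
    by (simp only: sum_distrib_left)
  also have "\<dots> = (\<Sum>x\<in>- {0}. weight (ind x mod int N) * K x
      + \<chi> (ind x) * part_sign S1 S2 (ind x mod int N) * K x)"
  proof (rule sum.cong[OF refl])
    fix x :: 'a assume x: "x \<in> - {0}"
    have chi: "\<chi> (ind x) = 1 \<or> \<chi> (ind x) = - 1" by (simp add: \<chi>_def)
    define k where "k = ind x mod int N"
    have "k \<in> S1 \<Longrightarrow> k \<in> I2 \<and> k \<notin> S2" "k \<in> S2 \<Longrightarrow> k \<in> I2" "k \<in> I2 \<Longrightarrow> k \<in> S1 \<or> k \<in> S2"
      "k \<in> I1 \<Longrightarrow> k \<notin> I2"
      using S_Un S_Int disjoint by auto
    then show "2 * (if x \<in> D then K x else 0) =
        weight (ind x mod int N) * K x + \<chi> (ind x) * part_sign S1 S2 (ind x mod int N) * K x"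
      using x chi unfolding mem_D k_def[symmetric] weight_def part_sign_def by auto
  qed
  finally show ?thesis by (simp only: sum.distrib)
qed

text \<open>The sum is half of 2r - Q weight(k) + T, with T the signed part. The weight is 2 with T
  = 0 on \<open>I1\<close>, it is 1 with T = \<plusminus>Q on \<open>I2\<close>, and both vanish
  elsewhere.\<close>

lemma char_sum_D:
  assumes y: "y \<noteq> 0"
  defines "k \<equiv> ind y mod int N"
  shows "(k \<in> I1 \<longrightarrow> (\<Sum>x\<in>D. \<psi> (tr (y * x))) = of_nat r - of_nat Q)
    \<and> (k \<in> I2 \<longrightarrow> (\<Sum>x\<in>D. \<psi> (tr (y * x))) \<in> {of_nat r, of_nat r - of_nat Q})
    \<and> (k \<notin> I1 \<and> k \<notin> I2 \<longrightarrow> (\<Sum>x\<in>D. \<psi> (tr (y * x))) = of_nat r)"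
proof -
  define \<theta> where "\<theta> = (\<Sum>x\<in>D. \<psi> (tr (y * x)))"
  define T where "T = (\<Sum>x\<in>- {0}. \<chi> (ind x) * part_sign S1 S2 (ind x mod int N) * \<psi> (tr (y * x)))"
  have T: "if k \<in> I2 then T = of_nat Q \<or> T = - of_nat Q else T = 0"
    unfolding k_def T_def by (rule sum_chi_psi[OF y])
  have "2 * \<theta> = 2 * of_nat r - of_nat Q * weight k + T"
    unfolding \<theta>_def T_def k_def sum_D sum_weight_psi[OF y] ..
  then have \<theta>: "\<theta> = of_nat r - of_nat Q * weight k / 2 + T / 2" by (simp add: field_simps)
  have "\<theta> = of_nat r - of_nat Q" if "k \<in> I1"
  proof -
    have "k \<notin> I2" using that disjoint by blast
    then show ?thesis using that T by (simp add: \<theta> weight_def)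
  qed
  moreover have "\<theta> \<in> {of_nat r, of_nat r - of_nat Q}" if "k \<in> I2"
  proof -
    have "k \<notin> I1" using that disjoint by blast
    then have w: "weight k = 1" using that by (simp add: weight_def)
    from T that have "T = of_nat Q \<or> T = - of_nat Q" by (simp only: if_True)
    then consider "T = of_nat Q" | "T = - of_nat Q" by blast
    then show ?thesis by cases (simp_all add: \<theta> w)
  qed
  moreover have "\<theta> = of_nat r" if "k \<notin> I1 \<and> k \<notin> I2"
    using that T by (simp add: \<theta> weight_def)
  ultimately show ?thesis unfolding \<theta>_def by blast
qed

text \<open>The case of a constant summand in \<open>sum_D\<close>: the unsigned part depends only
  on the norm, whose fibres have Q + 1 elements, and the signed part vanishes by
  \<open>twisted_sum_0\<close>.\<close>

lemma card_D: "card D = r * (Q + 1)"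
proof -
  have "(\<Sum>x\<in>- {0}. weight (ind x mod int N) * 1) = (\<Sum>x\<in>- {0}. weight (indF (nm x) mod int N))"
  proof (rule sum.cong[OF refl])
    fix x :: 'a assume "x \<in> - {0}"
    then show "weight (ind x mod int N) * 1 = weight (indF (nm x) mod int N)"
      using indF_nm_N[of x] by (simp add: cong_def)
  qed
  also have "\<dots> = of_nat (Q + 1) * (2 * of_nat r)"
    by (simp only: sum_nm[of "\<lambda>z. weight (indF z mod int N)"] sum_weight)
  finally have A: "(\<Sum>x\<in>- {0}. weight (ind x mod int N) * 1) = of_nat (Q + 1) * (2 * of_nat r)" .
  have "(\<Sum>x\<in>- {0}. \<chi> (ind x) * part_sign S1 S2 (ind x mod int N) * 1)
      = (\<Sum>x\<in>- {0}. \<chi> (ind x) * part_sign S1 S2 (indF (nm x) mod int N))"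
  proof (rule sum.cong[OF refl])
    fix x :: 'a assume "x \<in> - {0}"
    then show "\<chi> (ind x) * part_sign S1 S2 (ind x mod int N) * 1
        = \<chi> (ind x) * part_sign S1 S2 (indF (nm x) mod int N)"
      using indF_nm_N[of x] by (simp add: cong_def)
  qed
  also have "\<dots> = 0"
    by (rule twisted_sum_0[where \<chi> = \<chi>, OF chi_anti, where g = "\<lambda>z. part_sign S1 S2 (indF z mod int N)"])
  finally have "2 * (of_nat (card D) :: complex) = of_nat (Q + 1) * (2 * of_nat r)"
    using sum_D[of "\<lambda>_. 1"] A by simp
  then have "(of_nat (2 * card D) :: complex) = of_nat (2 * (r * (Q + 1)))" by (simp add: algebra_simps)
  then have "2 * card D = 2 * (r * (Q + 1))" by (simp only: of_nat_eq_iff)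
  then show ?thesis by simp
qed

text \<open>The logarithm of -1 is divisible by 4 and by N, and \<open>D\<close> depends on
  logarithms only modulo these.\<close>

lemma uminus_D: assumes "x \<in> D" shows "- x \<in> D"
proof -
  have x: "x \<noteq> 0" using assms mem_D by simp
  have "[ind (- 1 * x) = ind (- 1) + ind x] (mod int (Q\<^sup>2 - 1))" using x by (intro ind_mult) auto
  moreover have "int N dvd int (Q\<^sup>2 - 1)" by (rule dvd_trans[OF _ four_N_dvd]) simp
  ultimately have "[ind (- 1 * x) = ind (- 1) + ind x] (mod int N)" by (rule cong_dvd_modulus)
  also have "[ind (- 1) + ind x = 0 + ind x] (mod int N)"
    using ind_minus_1_N by (intro cong_add cong_refl) (simp add: cong_0_iff)
  finally have 1: "ind (- x) mod int N = ind x mod int N" by (simp add: cong_def)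
  have "[ind (- 1 * x) = ind (- 1) + ind x] (mod 4)" using x by (intro ind_mult_4) auto
  also have "[ind (- 1) + ind x = 0 + ind x] (mod 4)"
    using ind_minus_1 by (intro cong_add cong_refl) (simp add: cong_0_iff)
  finally have "\<chi> (ind (- x)) = \<chi> (ind x)" using chi_cong[where \<chi> = \<chi>, OF chi_anti] by simp
  then show ?thesis using assms unfolding mem_D 1 by simp
qed

text \<open>Both values occur because the extreme periods \<alpha>1 and \<alpha>3 are attained. They
  give r - Q and r respectively, whatever the signs on \<open>I2\<close>.\<close>

lemma char_values_D:
  "(\<lambda>y. \<Sum>x\<in>D. \<psi> (tr (y * x))) ` (- {0}) = {of_nat r, of_nat r - of_nat Q}"
proof
  show "(\<lambda>y. \<Sum>x\<in>D. \<psi> (tr (y * x))) ` (- {0}) \<subseteq> {of_nat r, of_nat r - of_nat Q}"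
  proof (rule image_subsetI)
    fix y :: 'a assume "y \<in> - {0}"
    then have "y \<noteq> 0" by simp
    from char_sum_D[OF this] show "(\<Sum>x\<in>D. \<psi> (tr (y * x))) \<in> {of_nat r, of_nat r - of_nat Q}"
      by blast
  qed
next
  have attained: "\<exists>y. y \<noteq> 0 \<and> period (ind y mod int N) = of_rat a"
    if "(of_rat a :: complex) \<in> {of_rat \<alpha>1, of_rat \<alpha>2, of_rat \<alpha>3}" for a
  proof -
    have "(of_rat a :: complex) \<in> period ` {0..<int N}" unfolding periods by (rule that)
    then obtain i where i: "period i = of_rat a" by (elim imageE) simp
    have "[ind (\<gamma> powi i) = i] (mod int (Q\<^sup>2 - 1))" by (rule ind_cong[THEN iffD1]) simp_all
    moreover have "int N dvd int (Q\<^sup>2 - 1)" by (rule dvd_trans[OF _ four_N_dvd]) simp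
    ultimately have "[ind (\<gamma> powi i) = i] (mod int N)" by (rule cong_dvd_modulus)
    then have "period (ind (\<gamma> powi i) mod int N) = period i" by (intro period_cong) (simp add: cong_def)
    then show ?thesis using i by (intro exI[of _ "\<gamma> powi i"]) simp
  qed
  have range: "k mod int N \<in> {0..<int N}" for k using N_pos by simp
  obtain y1 where y1: "y1 \<noteq> 0" "period (ind y1 mod int N) = of_rat \<alpha>1" using attained by blast
  then have "ind y1 mod int N \<in> I1" using range by (simp add: mem_I1)
  then have 1: "(\<Sum>x\<in>D. \<psi> (tr (y1 * x))) = of_nat r - of_nat Q" using char_sum_D[OF y1(1)] by blast
  obtain y3 where y3: "y3 \<noteq> 0" "period (ind y3 mod int N) = of_rat \<alpha>3" using attained by blast
  have "\<alpha>3 \<noteq> \<alpha>1" "\<alpha>3 \<noteq> \<alpha>2" using values_less by simp_all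
  then have "ind y3 mod int N \<notin> I1" "ind y3 mod int N \<notin> I2" using y3 by (simp_all add: mem_I1 mem_I2)
  then have 3: "(\<Sum>x\<in>D. \<psi> (tr (y3 * x))) = of_nat r" using char_sum_D[OF y3(1)] by blast
  show "{of_nat r, of_nat r - of_nat Q} \<subseteq> (\<lambda>y. \<Sum>x\<in>D. \<psi> (tr (y * x))) ` (- {0})"
  proof -
    have "of_nat r - of_nat Q \<in> (\<lambda>y. \<Sum>x\<in>D. \<psi> (tr (y * x))) ` (- {0})"
      by (rule image_eqI[of _ _ y1]) (use 1 y1 in simp_all)
    moreover have "of_nat r \<in> (\<lambda>y. \<Sum>x\<in>D. \<psi> (tr (y * x))) ` (- {0})"
      by (rule image_eqI[of _ _ y3]) (use 3 y3 in simp_all)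
    ultimately show ?thesis by simp
  qed
qed

lemma strongly_regular_D:
  "strongly_regular (Cay D) ((int Q)\<^sup>2) (int r * (int Q + 1))
     (- int Q + (int r)\<^sup>2 + 3 * int r) ((int r)\<^sup>2 + int r)"
proof (rule strongly_regular_Cay)
  show "0 \<notin> D" using mem_D by simp
  show "(\<Sum>x\<in>D. \<psi> (tr (y * x))) \<in> {of_nat r, of_nat r - of_nat Q}" if "y \<noteq> 0" for y
    using that char_values_D by blast
qed (use uminus_D card_D in auto)

end

section \<open>Elements of the prime field lie in class 0\<close>

lemma of_nat_power_CHAR_power: "(of_nat k :: 'a::finite_field) ^ (CHAR('a) ^ e) = of_nat k"
proof (induction k)
  case 0
  have "CHAR('a) ^ e > 0" by simp
  then show ?case by (simp add: zero_power)
next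
  case (Suc k)
  have "(1 + of_nat k :: 'a) ^ (CHAR('a) ^ e) = 1 ^ (CHAR('a) ^ e) + of_nat k ^ (CHAR('a) ^ e)"
    by (rule freshmans_dream') simp_all
  then show ?case using Suc by simp
qed

lemma diff_one_dvd_power_diff_one: "(q - 1 :: nat) dvd q ^ m - 1"
proof (cases "q = 0")
  case False
  have "int q ^ m - 1 = (int q - 1) * (\<Sum>i<m. int q ^ i)" by (rule power_diff_1_eq)
  then have "int (q - 1) dvd int (q ^ m - 1)" using False by (simp add: of_nat_diff)
  then show ?thesis by (simp only: int_dvd_int_iff)
qed (cases m, auto)

context quadratic_extension
begin

text \<open>Such an element satisfies x^(q - 1) = 1, so Q - 1 divides (q - 1) times its logarithm.
  Cancelling q - 1 leaves a multiple of (Q - 1)/(q - 1), and hence of N.\<close>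

lemma prime_field_indF:
  assumes q: "q = CHAR('a) ^ e" "q > 1" and Q: "Q = q ^ m" and k: "(of_nat k :: 'a) \<noteq> 0"
    and N: "N dvd (q ^ m - 1) div (q - 1)"
  shows "int N dvd indF (of_nat k)"
proof -
  obtain M where M: "q ^ m - 1 = (q - 1) * M" using diff_one_dvd_power_diff_one[of q m] by (elim dvdE)
  let ?x = "of_nat k :: 'a"
  have "?x * ?x ^ (q - 1) = ?x ^ q" using q(2) by (subst power_Suc[symmetric]) simp
  also have "\<dots> = ?x" unfolding q(1) by (rule of_nat_power_CHAR_power)
  finally have "?x ^ (q - 1) = 1" using k by simp
  moreover have "?x ^ (q - 1) = \<omega> powi (indF ?x * int (q - 1))"
    using indF_powi[OF F_of_nat k] by (simp only: power_int_power'[symmetric])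
  ultimately have "\<omega> powi (indF ?x * int (q - 1)) = \<omega> powi 0" by simp
  then have "int (Q - 1) dvd indF ?x * int (q - 1)" unfolding omega_powi_eq_iff cong_0_iff .
  then have "int M * int (q - 1) dvd indF ?x * int (q - 1)"
    unfolding Q M by (simp only: of_nat_mult mult.commute)
  then have "int M dvd indF ?x" using q(2) by (subst (asm) dvd_mult_cancel_right) auto
  moreover have "N dvd M" using N q(2) unfolding M by simp
  ultimately show ?thesis by (meson dvd_trans int_dvd_int_iff)
qed

end

theorem mainTheorem2:
  fixes q m N :: nat
    and \<gamma> \<omega> :: "'a::finite_field"
    and \<alpha>\<^sub>1 \<alpha>\<^sub>2 \<alpha>\<^sub>3 :: rat
    and I\<^sub>1 I\<^sub>2 S\<^sub>1 S\<^sub>2 :: "int set"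
  assumes "primepow q" and "m > 0" and "q ^ m mod 4 = 3"
    and "odd N" and "N dvd (q ^ m - 1) div (q - 1)"
    and "card (UNIV :: 'a set) = q ^ (2 * m)"
    and "primitive_element \<gamma>" and "\<omega> = \<gamma> ^ (q ^ m + 1)"
    and "(\<lambda>i. add_char_sum (q ^ m) (cyclotomic_class \<omega> N i)) ` {0..<int N} =
           {of_rat \<alpha>\<^sub>1, of_rat \<alpha>\<^sub>2, of_rat \<alpha>\<^sub>3}"
    and "\<alpha>\<^sub>1 - \<alpha>\<^sub>2 = \<alpha>\<^sub>2 - \<alpha>\<^sub>3" and "\<alpha>\<^sub>2 - \<alpha>\<^sub>3 > 0"
    and "I\<^sub>1 = gauss_period_level \<omega> (q ^ m) N \<alpha>\<^sub>1"
    and "I\<^sub>2 = gauss_period_level \<omega> (q ^ m) N \<alpha>\<^sub>2"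
    and "S\<^sub>1 \<union> S\<^sub>2 = I\<^sub>2" and "S\<^sub>1 \<inter> S\<^sub>2 = {}"
    and "\<And>c::int.
           (let d = 2 * add_char_sum (q ^ m)
                      ((*) (\<omega> powi c) ` (\<Union>l\<in>X_index N S\<^sub>1 S\<^sub>2. cyclotomic_class \<omega> (2 * N) l))
                  - add_char_sum (q ^ m)
                      ((*) (\<omega> powi c) ` (\<Union>l\<in>inv_scale N 2 I\<^sub>2. cyclotomic_class \<omega> N l));
                G = gauss_sum (q ^ m) (quadratic_char (q ^ m) :: 'a \<Rightarrow> complex)
            in if c mod int N \<in> inv_scale N 2 I\<^sub>2 then d = G \<or> d = - G else d = 0)"
  shows "(\<lambda>y. add_char_sum (q ^ (2 * m)) ((*) y ` D_set \<gamma> N I\<^sub>1 S\<^sub>1 S\<^sub>2)) ` (- {0}) =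
           {(of_nat q ^ m - 1) * (2 * of_nat (card I\<^sub>1) + of_nat (card I\<^sub>2)) / (2 * of_nat N),
            - (of_nat q ^ m) +
              (of_nat q ^ m - 1) * (2 * of_nat (card I\<^sub>1) + of_nat (card I\<^sub>2)) / (2 * of_nat N)}
       \<and> (\<exists>r::nat.
            real r = (real (card I\<^sub>2) + 2 * real (card I\<^sub>1)) * (real q ^ m - 1) / (2 * real N) \<and>
            strongly_regular (Cay (D_set \<gamma> N I\<^sub>1 S\<^sub>1 S\<^sub>2))
              (int q ^ (2 * m)) (int r * (int q ^ m + 1))
              (- (int q ^ m) + (int r)\<^sup>2 + 3 * int r) ((int r)\<^sup>2 + int r))
       \<and> negative_latin_square_type (Cay (D_set \<gamma> N I\<^sub>1 S\<^sub>1 S\<^sub>2))"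
proof -
  obtain p e where p: "prime p" "e > 0" "q = p ^ e" using assms(1) unfolding primepow_def by blast
  \<comment> \<open>The characteristic divides the order of the field, a power of p, and is
    therefore p. This supplies the exponent of Q required by
    \<open>quadratic_extension\<close>.\<close>
  have "CHAR('a) dvd p ^ (e * (2 * m))"
    using CHAR_dvd_CARD[where ?'a = 'a] assms(6) p(3) by (simp add: power_mult)
  then have "CHAR('a) dvd p" using CHAR_prime[where ?'a = 'a] prime_dvd_power by blast
  then have char: "CHAR('a) = p" using p(1) CHAR_prime[where ?'a = 'a] primes_dvd_imp_eq by blast
  have q1: "q > 1" using assms(1) by (rule primepow_gt_Suc_0[unfolded One_nat_def[symmetric]])
  have Q2: "q ^ (2 * m) = (q ^ m)\<^sup>2" by (simp add: power_mult mult.commute)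
  interpret quadratic_extension \<gamma> "q ^ m" "e * m"
    by unfold_locales (use assms char p Q2 in \<open>simp_all add: power_mult\<close>)
  have \<omega>: "\<omega> = local.\<omega>" unfolding \<omega>_def by (rule assms(8))
  have two: "int N dvd indF 2"
    using prime_field_indF[of q e m 2 N] p char q1 assms(5) by simp
  have "(q ^ m - 1) div (q - 1) dvd q ^ m - 1"
    using diff_one_dvd_power_diff_one[of q m] by (metis dvd_div_mult_self dvd_triv_left)
  with assms(5) have NQ: "N dvd q ^ m - 1" by (rule dvd_trans)
  interpret cyclotomic_classes \<gamma> "q ^ m" "e * m" N
    by unfold_locales (use assms(4) NQ two in simp_all)
  have I: "I\<^sub>1 = {i \<in> {0..<int N}. period i = of_rat \<alpha>\<^sub>1}" "I\<^sub>2 = {i \<in> {0..<int N}. period i = of_rat \<alpha>\<^sub>2}"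
    unfolding assms(12,13) gauss_period_level_def period_def \<omega> by (rule refl)+
  then have I2: "I\<^sub>2 \<subseteq> {0..<int N}" by blast
  interpret three_valued_periods \<gamma> "q ^ m" "e * m" N \<alpha>\<^sub>1 \<alpha>\<^sub>2 \<alpha>\<^sub>3 I\<^sub>1 I\<^sub>2 S\<^sub>1 S\<^sub>2
  proof unfold_locales
    show "period ` {0..<int N} = {of_rat \<alpha>\<^sub>1, of_rat \<alpha>\<^sub>2, of_rat \<alpha>\<^sub>3}"
      using assms(9) unfolding period_def[abs_def] \<omega> .
    show "if (2 * c) mod int N \<in> I\<^sub>2
        then twisted_period S\<^sub>1 S\<^sub>2 c = gauss_sum (q ^ m) (quadratic_char (q ^ m) :: 'a \<Rightarrow> complex)
          \<or> twisted_period S\<^sub>1 S\<^sub>2 c = - gauss_sum (q ^ m) (quadratic_char (q ^ m) :: 'a \<Rightarrow> complex)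
        else twisted_period S\<^sub>1 S\<^sub>2 c = 0" for c
      using assms(16)[of c]
      unfolding Let_def \<omega> twisted_period_eq[OF assms(14,15) I2] mem_inv_scale_2[OF I2] .
  qed (rule assms I)+
  have r: "of_nat r = (of_nat q ^ m - 1) * (2 * of_nat (card I\<^sub>1) + of_nat (card I\<^sub>2)) / (2 * of_nat N :: complex)"
    "real r = (real q ^ m - 1) * (2 * real (card I\<^sub>1) + real (card I\<^sub>2)) / (2 * real N)"
    by (simp_all add: of_nat_r)
  have image: "add_char_sum (q ^ (2 * m)) ((*) y ` D) = (\<Sum>x\<in>D. add_char (q ^ m) (tr (y * x)))"
    if "y \<in> - {0}" for y
    unfolding add_char_sum_def Q2 using that by (subst sum.reindex) (auto simp: inj_on_def add_char_square)
  have "(\<lambda>y. add_char_sum (q ^ (2 * m)) ((*) y ` D)) ` (- {0}) = {of_nat r, of_nat r - of_nat (q ^ m)}"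
    unfolding char_values_D[symmetric] by (rule image_cong[OF refl image])
  then have "(\<lambda>y. add_char_sum (q ^ (2 * m)) ((*) y ` D)) ` (- {0}) = {of_nat r, - (of_nat q ^ m) + of_nat r}"
    by simp
  then have char_vals: "(\<lambda>y. add_char_sum (q ^ (2 * m)) ((*) y ` D)) ` (- {0}) =
      {(of_nat q ^ m - 1) * (2 * of_nat (card I\<^sub>1) + of_nat (card I\<^sub>2)) / (2 * of_nat N),
       - (of_nat q ^ m) + (of_nat q ^ m - 1) * (2 * of_nat (card I\<^sub>1) + of_nat (card I\<^sub>2)) / (2 * of_nat N)}"
    unfolding r(1) .
  have "real r = (real (card I\<^sub>2) + 2 * real (card I\<^sub>1)) * (real q ^ m - 1) / (2 * real N)"
    using r(2) by (simp add: ac_simps)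
  moreover have "strongly_regular (Cay D) (int q ^ (2 * m)) (int r * (int q ^ m + 1))
      (- (int q ^ m) + (int r)\<^sup>2 + 3 * int r) ((int r)\<^sup>2 + int r)"
    using strongly_regular_D by (simp add: power_mult mult.commute)
  moreover have "negative_latin_square_type (Cay D)"
    unfolding negative_latin_square_type_def using strongly_regular_D by blast
  ultimately show ?thesis using char_vals by blast
qed

end
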